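(* For $1\le k\le n$ the function $S_k(\lambda)=-\dfrac{r_k(-\lambda)}{r_k(\lambda)}$ is the scattering coefficient of the pair $\{L_k,L_{k-1}\}$, i.e. $$S_k(\lambda)=\frac{\widetilde e_k(-\lambda,0)}{\widetilde e_k(\lambda,0)}$$ for $\lambda\in\mathbb{R}\setminus\{0\}$ for which the boundary values involved exist and the denominators do not vanish. Here $\widetilde e_k(\lambda,x)$ is the Jost solution of $L_k$ calculated from the normalized Jost solution $\widehat e_{k-1}(\lambda,x)=e_{k-1}(\lambda,x)/e_{k-1}(\lambda,0)$ (so $\widehat e_{k-1}(\lambda,0)=1$) of the non-perturbed operator $L_{k-1}$ by the formula $$\widetilde e_k(\lambda,x)=-\bigl(1+\alpha_k\langle R_{k-1}(\lambda^2)v_k,v_k\rangle\bigr)\widehat e_{k-1}(\lambda,x)+\alpha_k\langle\widehat e_{k-1},v_k\rangle\,(R_{k-1}(\lambda^2)v_k)(x).$$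
   Context: Let $n\in\mathbb{N}$, let $\alpha_1,\dots,\alpha_n$ be non-zero real numbers, and let $v_1,\dots,v_n$ be linearly independent complex-valued functions on $\mathbb{R}_+=(0,\infty)$ with $\int_{\mathbb{R}_+}(1+x^2)|v_k(x)|^2dx<\infty$ for all $k$. $\langle f,g\rangle=\int_{\mathbb{R}_+}f\overline g\,dx$ (whenever the integral converges absolutely). Operators: $L_0y=-y''$ in $L^2(\mathbb{R}_+)$ with domain $\{y\in W_2^2(\mathbb{R}_+):y(0)=0\}$; $L_k=L_0+\sum_{s=1}^k\alpha_s\langle\cdot,v_s\rangle v_s$ ($0\le k\le n$); $R_k(z)=(L_k-zI)^{-1}$ for $z\in\mathbb{C}\setminus\mathbb{R}$. Put $b_k(z)=1+\alpha_k\langle R_{k-1}(z)v_k,v_k\rangle$ and $r_k(\lambda)=-\frac{2i\lambda}{\alpha_k}b_k(\lambda^2)$. For real $\lambda\ne0$ all expressions containing $R_{k-1}(\lambda^2)$ or $b_k(\lambda^2)$ are understood as boundary values from the upper half-plane, i.e. limits as $\varepsilon\to+0$ of the same expressions with $\lambda$ replaced by $\lambda+i\varepsilon$; the value of a function at $-\lambda$ is its value at the real point $-\lambda$ (so $\lambda^2$ is then approached as $(-\lambda+i\varepsilon)^2$). Jost solutions: $e_0(\lambda,x)=e^{i\lambda x}$. For $1\le k\le n$ and real $\lambda\ne0$, $e_k(\lambda,x)$ is defined as follows. Let $\widetilde v_j^*(\lambda)=\int_{\mathbb{R}_+}e^{i\lambda x}\overline{v_j(x)}\,dx$, $\psi_j(\lambda,x)=\int_x^\infty\frac{\sin\lambda(t-x)}{\lambda}v_j(t)\,dt$,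 $\varphi_{s,j}(\lambda)=\int_{\mathbb{R}_+}\psi_s(\lambda,x)\overline{v_j(x)}\,dx$. Let $M$ be the $k\times k$ matrix with entry $\alpha_s\varphi_{s,j}(\lambda)-\delta_{s,j}$ in row $j$, column $s$ ($1\le j,s\le k$), and $M_s$ the matrix $M$ with its $s$-th column replaced by $(\widetilde v_1^*(\lambda),\dots,\widetilde v_k^*(\lambda))^T$. Then $e_k(\lambda,x)=e^{i\lambda x}\det M-\sum_{s=1}^k\alpha_s\det(M_s)\,\psi_s(\lambda,x)$. *)

theory Defs
  imports "HOL-Analysis.Analysis" "Jordan_Normal_Form.Determinant"
begin

abbreviation Rplus :: "real measure" where
  "Rplus \<equiv> lebesgue_on {0<..}"

text \<open>Elements of \<open>L\<^sup>2(0,\<infinity>)\<close> are represented by functions; identities between them are stated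
  almost everywhere.\<close>

definition L2 :: "(real \<Rightarrow> complex) set" where
  "L2 = {f \<in> borel_measurable Rplus. integrable Rplus (\<lambda>x. (cmod (f x))\<^sup>2)}"

definition ip :: "(real \<Rightarrow> complex) \<Rightarrow> (real \<Rightarrow> complex) \<Rightarrow> complex" where
  "ip f g = (LINT x|Rplus. f x * cnj (g x))"

definition lin_indep :: "nat \<Rightarrow> (nat \<Rightarrow> real \<Rightarrow> complex) \<Rightarrow> bool" where
  "lin_indep n v \<longleftrightarrow>
     (\<forall>c :: nat \<Rightarrow> complex. (AE x in Rplus. (\<Sum>k=1..n. c k * v k x) = 0) \<longrightarrow> (\<forall>k\<in>{1..n}. c k = 0))"

text \<open>\<open>y\<close> is absolutely continuous on every \<open>[0,b]\<close>, with derivative \<open>g\<close> almost everywhere.\<close>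

definition ac_deriv :: "(real \<Rightarrow> complex) \<Rightarrow> (real \<Rightarrow> complex) \<Rightarrow> bool" where
  "ac_deriv y g \<longleftrightarrow>
     (\<forall>x\<ge>0. set_integrable lebesgue {0..x} g \<and> y x = y 0 + (LINT t:{0..x}|lebesgue. g t))"

definition is_deriv2 :: "(real \<Rightarrow> complex) \<Rightarrow> (real \<Rightarrow> complex) \<Rightarrow> bool" where
  "is_deriv2 y h \<longleftrightarrow> h \<in> L2 \<and> (\<exists>g\<in>L2. ac_deriv y g \<and> ac_deriv g h)"

text \<open>An element of \<open>W\<^sub>2\<^sup>2\<close> is represented by its continuous version on \<open>[0,\<infinity>)\<close>, so that
  \<open>y 0\<close> is the boundary value; setting it to \<open>0\<close> on the negative half-line makes the
  representative unique as a function on the whole type.\<close>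

definition W22 :: "(real \<Rightarrow> complex) set" where
  "W22 = {y \<in> L2. (\<exists>h. is_deriv2 y h) \<and> (\<forall>x<0. y x = 0)}"

text \<open>For \<open>y \<in> W22\<close> the second derivative is determined up to a null set.\<close>

definition deriv2 :: "(real \<Rightarrow> complex) \<Rightarrow> real \<Rightarrow> complex" where
  "deriv2 y = (SOME h. is_deriv2 y h)"

text \<open>All the operators \<open>L\<^sub>k\<close> have the domain of \<open>L\<^sub>0\<close>, the perturbation being bounded.\<close>

definition dom_L :: "(real \<Rightarrow> complex) set" where
  "dom_L = {y \<in> W22. y 0 = 0}"

definition op_L ::
  "(nat \<Rightarrow> real) \<Rightarrow> (nat \<Rightarrow> real \<Rightarrow> complex) \<Rightarrow> nat \<Rightarrow> (real \<Rightarrow> complex) \<Rightarrow> real \<Rightarrow> complex" where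
  "op_L \<alpha> v k y = (\<lambda>x. - deriv2 y x + (\<Sum>s=1..k. complex_of_real (\<alpha> s) * ip y (v s) * v s x))"

definition resolvent ::
  "(nat \<Rightarrow> real) \<Rightarrow> (nat \<Rightarrow> real \<Rightarrow> complex) \<Rightarrow> nat \<Rightarrow> complex \<Rightarrow> (real \<Rightarrow> complex) \<Rightarrow> real \<Rightarrow> complex" where
  "resolvent \<alpha> v k z f = (THE y. y \<in> dom_L \<and> (AE x in Rplus. op_L \<alpha> v k y x - z * y x = f x))"

definition b_fun :: "(nat \<Rightarrow> real) \<Rightarrow> (nat \<Rightarrow> real \<Rightarrow> complex) \<Rightarrow> nat \<Rightarrow> complex \<Rightarrow> complex" where
  "b_fun \<alpha> v k z = 1 + complex_of_real (\<alpha> k) * ip (resolvent \<alpha> v (k - 1) z (v k)) (v k)"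

definition r_fun :: "(nat \<Rightarrow> real) \<Rightarrow> (nat \<Rightarrow> real \<Rightarrow> complex) \<Rightarrow> nat \<Rightarrow> complex \<Rightarrow> complex" where
  "r_fun \<alpha> v k \<mu> = - (2 * \<i> * \<mu> / complex_of_real (\<alpha> k)) * b_fun \<alpha> v k (\<mu>\<^sup>2)"

text \<open>Boundary value at the real point \<open>lam\<close> of a function of \<open>lam\<close> in the upper half-plane. The
  approach is in \<open>lam\<close>, not in the spectral parameter \<open>lam\<^sup>2\<close>, which thus tends to its limit from
  above if \<open>lam > 0\<close> and from below if \<open>lam < 0\<close>.\<close>

definition upper_path :: "real \<Rightarrow> real \<Rightarrow> complex" where
  "upper_path lam \<epsilon> = complex_of_real lam + \<i> * complex_of_real \<epsilon>"

definition bv_exists :: "(complex \<Rightarrow> complex) \<Rightarrow> real \<Rightarrow> bool" where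
  "bv_exists F lam \<longleftrightarrow> (\<exists>l. ((\<lambda>\<epsilon>. F (upper_path lam \<epsilon>)) \<longlongrightarrow> l) (at_right 0))"

definition bv :: "(complex \<Rightarrow> complex) \<Rightarrow> real \<Rightarrow> complex" where
  "bv F lam = Lim (at_right 0) (\<lambda>\<epsilon>. F (upper_path lam \<epsilon>))"

definition scat_coeff :: "(nat \<Rightarrow> real) \<Rightarrow> (nat \<Rightarrow> real \<Rightarrow> complex) \<Rightarrow> nat \<Rightarrow> real \<Rightarrow> complex" where
  "scat_coeff \<alpha> v k lam = - (bv (r_fun \<alpha> v k) (- lam) / bv (r_fun \<alpha> v k) lam)"

definition v_star :: "(real \<Rightarrow> complex) \<Rightarrow> real \<Rightarrow> complex" where
  "v_star w lam = (LINT x|Rplus. exp (\<i> * complex_of_real (lam * x)) * cnj (w x))"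

definition psi :: "(real \<Rightarrow> complex) \<Rightarrow> real \<Rightarrow> real \<Rightarrow> complex" where
  "psi w lam x = (LINT t:{x<..}|lebesgue. complex_of_real (sin (lam * (t - x)) / lam) * w t)"

definition phi :: "(real \<Rightarrow> complex) \<Rightarrow> (real \<Rightarrow> complex) \<Rightarrow> real \<Rightarrow> complex" where
  "phi w u lam = (LINT x|Rplus. psi w lam x * cnj (u x))"

text \<open>The matrices below are indexed from \<open>0\<close>: entry \<open>(i, l)\<close> belongs to row \<open>j = i + 1\<close> and
  column \<open>s = l + 1\<close>.\<close>

definition jost_mat ::
  "(nat \<Rightarrow> real) \<Rightarrow> (nat \<Rightarrow> real \<Rightarrow> complex) \<Rightarrow> nat \<Rightarrow> real \<Rightarrow> complex Matrix.mat" where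
  "jost_mat \<alpha> v k lam = Matrix.mat k k (\<lambda>(i, l).
     complex_of_real (\<alpha> (l + 1)) * phi (v (l + 1)) (v (i + 1)) lam - (if l = i then 1 else 0))"

definition jost_mat_col ::
  "(nat \<Rightarrow> real) \<Rightarrow> (nat \<Rightarrow> real \<Rightarrow> complex) \<Rightarrow> nat \<Rightarrow> nat \<Rightarrow> real \<Rightarrow> complex Matrix.mat" where
  "jost_mat_col \<alpha> v k s lam =
     replace_col (jost_mat \<alpha> v k lam) (Matrix.vec k (\<lambda>i. v_star (v (i + 1)) lam)) (s - 1)"

definition jost ::
  "(nat \<Rightarrow> real) \<Rightarrow> (nat \<Rightarrow> real \<Rightarrow> complex) \<Rightarrow> nat \<Rightarrow> real \<Rightarrow> real \<Rightarrow> complex" where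
  "jost \<alpha> v k lam x =
     (if k = 0 then exp (\<i> * complex_of_real (lam * x))
      else exp (\<i> * complex_of_real (lam * x)) * Determinant.det (jost_mat \<alpha> v k lam)
           - (\<Sum>s=1..k. complex_of_real (\<alpha> s) * Determinant.det (jost_mat_col \<alpha> v k s lam)
                         * psi (v s) lam x))"

definition jost_hat ::
  "(nat \<Rightarrow> real) \<Rightarrow> (nat \<Rightarrow> real \<Rightarrow> complex) \<Rightarrow> nat \<Rightarrow> real \<Rightarrow> real \<Rightarrow> complex" where
  "jost_hat \<alpha> v k lam x = jost \<alpha> v k lam x / jost \<alpha> v k lam 0"

definition jost_tilde ::
  "(nat \<Rightarrow> real) \<Rightarrow> (nat \<Rightarrow> real \<Rightarrow> complex) \<Rightarrow> nat \<Rightarrow> real \<Rightarrow> real \<Rightarrow> complex" where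
  "jost_tilde \<alpha> v k lam x =
     - bv (\<lambda>\<mu>. 1 + complex_of_real (\<alpha> k) * ip (resolvent \<alpha> v (k - 1) (\<mu>\<^sup>2) (v k)) (v k)) lam
         * jost_hat \<alpha> v (k - 1) lam x
     + complex_of_real (\<alpha> k) * ip (jost_hat \<alpha> v (k - 1) lam) (v k)
         * bv (\<lambda>\<mu>. resolvent \<alpha> v (k - 1) (\<mu>\<^sup>2) (v k) x) lam"

end

theory Submission
  imports Defs
begin

text \<open>At \<open>x = 0\<close> the term of \<open>jost_tilde\<close> containing the resolvent drops out, because
  \<open>R\<^sub>k\<^sub>-\<^sub>1(z) v\<^sub>k\<close> lies in the domain and hence vanishes at \<open>0\<close>; so
  \<open>jost_tilde\<close> at \<open>0\<close> is \<open>- b\<^sub>k(\<lambda>\<^sup>2)\<close>, and the factors \<open>\<mp> 2 i \<lambda> / \<alpha>\<^sub>k\<close> in the quotient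
  of the \<open>r\<^sub>k\<close> cancel up to the sign. What needs work is that the resolvent, a definite
  description, is well defined for non-real \<open>z\<close>. Uniqueness is the symmetry of \<open>L\<^sub>k\<close>, by
  integration by parts for absolutely continuous functions. Existence for \<open>L\<^sub>0\<close> is variation
  of constants, and passing from \<open>L\<^sub>k\<close> to \<open>L\<^sub>k\<^sub>+\<^sub>1\<close> is a rank-one update, whose denominator
  \<open>1 + \<alpha> \<langle>R v, v\<rangle>\<close> cannot vanish since otherwise \<open>R v\<close> would be an eigenfunction with
  eigenvalue \<open>z\<close>.\<close>

section \<open>Absolutely continuous functions on the half-line\<close>

lemma borel_representative_complex:
  fixes f :: "'a \<Rightarrow> complex"
  assumes "f \<in> borel_measurable (completion M)"
  obtains g where "g \<in> borel_measurable M" "AE x in M. f x = g x"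
proof -
  have "(\<lambda>x. Re (f x)) \<in> borel_measurable (completion M)" "(\<lambda>x. Im (f x)) \<in> borel_measurable (completion M)"
    using assms by simp_all
  then obtain r i where ri: "r \<in> borel_measurable M" "AE x in M. Re (f x) = r x"
      "i \<in> borel_measurable M" "AE x in M. Im (f x) = i x"
    using completion_ex_borel_measurable_real by metis
  have "(\<lambda>x. Complex (r x) (i x)) \<in> borel_measurable M"
    using ri(1,3) by (simp add: borel_measurable_complex_iff)
  moreover have "AE x in M. f x = Complex (r x) (i x)"
    using ri(2,4) by eventually_elim (simp add: complex_eq_iff)
  ultimately show ?thesis by (rule that)
qed

text \<open>Both sides are iterated integrals of \<open>U s * H t\<close> over the triangle s \<le>
  t, and Fubini applies because the product \<open>U s * H t\<close> is integrable over the whole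
  plane. This is the core of the product rule \<open>ac_deriv_mult\<close>.\<close>

lemma lborel_integral_swap_triangle:
  fixes H U :: "real \<Rightarrow> complex"
  assumes [measurable]: "integrable lborel H" "integrable lborel U"
  shows "(LINT t|lborel. H t * (LINT s|lborel. indicator {..t} s *\<^sub>R U s))
       = (LINT s|lborel. U s * (LINT t|lborel. indicator {s..} t *\<^sub>R H t))"
proof -
  define F where "F = (\<lambda>(s, t). if s \<le> t then U s * H t else 0)"
  have Fm [measurable]: "F \<in> borel_measurable (lborel \<Otimes>\<^sub>M lborel)"
    unfolding F_def by measurable
  have "integrable (lborel \<Otimes>\<^sub>M lborel) (\<lambda>(s, t). U s * H t)"
  proof (rule lborel_pair.Fubini_integrable)
    show "integrable lborel (\<lambda>x. LINT y|lborel. norm (case (x, y) of (s, t) \<Rightarrow> U s * H t))"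
      using assms by (simp add: norm_mult)
  qed (use assms in simp_all)
  then have int: "integrable (lborel \<Otimes>\<^sub>M lborel) F"
    by (rule Bochner_Integration.integrable_bound) (auto simp: F_def)
  have "(LINT t|lborel. LINT s|lborel. F (s, t)) = (LINT s|lborel. LINT t|lborel. F (s, t))"
    by (rule lborel_pair.Fubini_integral) (use int in simp)
  moreover have "(LINT s|lborel. F (s, t)) = H t * (LINT s|lborel. indicator {..t} s *\<^sub>R U s)" for t
    unfolding integral_mult_right_zero[symmetric]
    by (rule Bochner_Integration.integral_cong) (auto simp: F_def indicator_def)
  moreover have "(LINT t|lborel. F (s, t)) = U s * (LINT t|lborel. indicator {s..} t *\<^sub>R H t)" for s
    unfolding integral_mult_right_zero[symmetric]
    by (rule Bochner_Integration.integral_cong) (auto simp: F_def indicator_def)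
  ultimately show ?thesis by simp
qed

text \<open>Replacing \<open>H\<close> and \<open>U\<close> by Borel representatives changes neither
  the inner nor the outer integrals, so the swap for \<open>lborel\<close> carries over to its
  completion.\<close>

lemma lebesgue_integral_swap_triangle:
  fixes H U :: "real \<Rightarrow> complex"
  assumes H: "integrable lebesgue H" and U: "integrable lebesgue U"
  shows "(LINT t|lebesgue. H t * (LINT s:{..t}|lebesgue. U s))
       = (LINT s|lebesgue. U s * (LINT t:{s..}|lebesgue. H t))"
proof -
  obtain H' where H': "H' \<in> borel_measurable lborel" "AE x in lborel. H x = H' x"
    using borel_representative_complex[of H lborel] H by (auto dest: borel_measurable_integrable)
  obtain U' where U': "U' \<in> borel_measurable lborel" "AE x in lborel. U x = U' x"
    using borel_representative_complex[of U lborel] U by (auto dest: borel_measurable_integrable)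
  note [measurable] = H'(1) U'(1)
  have aeH: "AE x in lebesgue. H x = H' x" and aeU: "AE x in lebesgue. U x = U' x"
    using H'(2) U'(2) by (simp_all add: AE_completion_iff)
  have iH: "integrable lborel H'" and iU: "integrable lborel U'"
    using integrable_cong_AE_imp[OF H _ aeH] integrable_cong_AE_imp[OF U _ aeU]
      H'(1) U'(1) by (simp_all add: integrable_completion measurable_completion)
  have setint: "(LINT x:A|lebesgue. f x) = (LINT x|lborel. indicator A x *\<^sub>R f' x)"
    if "AE x in lebesgue. f x = f' x" "integrable lebesgue f" "f' \<in> borel_measurable lborel" "A \<in> sets borel"
    for A and f f' :: "real \<Rightarrow> complex"
  proof -
    note [measurable] = that(3,4)
    have "(LINT x:A|lebesgue. f x) = (LINT x|lebesgue. indicator A x *\<^sub>R f' x)"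
      unfolding set_lebesgue_integral_def
    proof (rule integral_cong_AE)
      show "(\<lambda>x. indicat_real A x *\<^sub>R f x) \<in> borel_measurable lebesgue"
        using that(2,4) by (intro borel_measurable_scaleR borel_measurable_indicator) auto
      show "(\<lambda>x. indicat_real A x *\<^sub>R f' x) \<in> borel_measurable lebesgue"
        by (rule measurable_completion) measurable
      show "AE x in lebesgue. indicat_real A x *\<^sub>R f x = indicat_real A x *\<^sub>R f' x"
        using that(1) by eventually_elim simp
    qed
    also have "\<dots> = (LINT x|lborel. indicator A x *\<^sub>R f' x)"
      by (rule integral_completion) simp
    finally show ?thesis .
  qed
  have eq: "(LINT t|lebesgue. f t * c t) = (LINT t|lborel. f' t * c t)"
    if "AE x in lebesgue. f x = f' x" "integrable lebesgue f" "f' \<in> borel_measurable lborel" "c \<in> borel_measurable lborel"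
    for c and f f' :: "real \<Rightarrow> complex"
  proof -
    note [measurable] = that(3,4)
    have "(LINT t|lebesgue. f t * c t) = (LINT t|lebesgue. f' t * c t)"
    proof (rule integral_cong_AE)
      show "(\<lambda>x. f x * c x) \<in> borel_measurable lebesgue"
        using borel_measurable_integrable[OF that(2)] measurable_completion[OF that(4)]
        by (rule borel_measurable_times)
      show "(\<lambda>x. f' x * c x) \<in> borel_measurable lebesgue"
        by (intro borel_measurable_times measurable_completion that)
      show "AE x in lebesgue. f x * c x = f' x * c x"
        using that(1) by eventually_elim simp
    qed
    also have "\<dots> = (LINT t|lborel. f' t * c t)"
      by (rule integral_completion) simp
    finally show ?thesis .
  qed
  \<comment> \<open>Written with a conditional in place of the indicator, the integrand is visibly
    jointly measurable in s and t.\<close>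
  have "(\<lambda>t. LINT s|lborel. (if s \<le> t then 1 else 0) *\<^sub>R U' s) \<in> borel_measurable lborel"
    by measurable
  moreover have "(\<lambda>t. LINT s|lborel. (if s \<le> t then 1 else 0) *\<^sub>R U' s)
      = (\<lambda>t. LINT s|lborel. indicator {..t} s *\<^sub>R U' s)"
    by (intro ext Bochner_Integration.integral_cong) (auto simp: indicator_def)
  ultimately have m1: "(\<lambda>t. LINT s|lborel. indicator {..t} s *\<^sub>R U' s) \<in> borel_measurable lborel"
    by simp
  have "(\<lambda>s. LINT t|lborel. (if s \<le> t then 1 else 0) *\<^sub>R H' t) \<in> borel_measurable lborel"
    by measurable
  moreover have "(\<lambda>s. LINT t|lborel. (if s \<le> t then 1 else 0) *\<^sub>R H' t)
      = (\<lambda>s. LINT t|lborel. indicator {s..} t *\<^sub>R H' t)"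
    by (intro ext Bochner_Integration.integral_cong) (auto simp: indicator_def)
  ultimately have m2: "(\<lambda>s. LINT t|lborel. indicator {s..} t *\<^sub>R H' t) \<in> borel_measurable lborel"
    by simp
  show ?thesis
    using lborel_integral_swap_triangle[OF iH iU]
    by (simp add: setint[OF aeH H H'(1)] setint[OF aeU U U'(1)] eq[OF aeH H H'(1) m1] eq[OF aeU U U'(1) m2])
qed

section \<open>Calculus of absolutely continuous functions\<close>

lemma ac_deriv_iff:
  "ac_deriv y g \<longleftrightarrow> (\<forall>x\<ge>0. g absolutely_integrable_on {0..x} \<and> y x = y 0 + integral {0..x} g)"
  \<comment> \<open>\<open>absolutely_integrable_on\<close> is integrability with respect to
    \<open>lebesgue\<close>, so only the integral changes, from Lebesgue to gauge; this opens the
    way to continuity, combination of intervals and the fundamental theorem.\<close>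
  unfolding ac_deriv_def by (metis set_lebesgue_integral_eq_integral(2))

lemma ac_derivD:
  assumes "ac_deriv y g" "0 \<le> x"
  shows "g absolutely_integrable_on {0..x}" "y x - y 0 = integral {0..x} g"
    "(LINT t:{0..x}|lebesgue. g t) = y x - y 0"
proof -
  show "g absolutely_integrable_on {0..x}"
    using assms unfolding ac_deriv_iff by blast
  have "y x = y 0 + integral {0..x} g"
    using assms unfolding ac_deriv_iff by blast
  then show "y x - y 0 = integral {0..x} g" by (metis add_diff_cancel_left')
  have "y x = y 0 + (LINT t:{0..x}|lebesgue. g t)"
    using assms unfolding ac_deriv_def by blast
  then show "(LINT t:{0..x}|lebesgue. g t) = y x - y 0" by (metis add_diff_cancel_left')
qed

lemma ac_deriv_continuous_on:
  assumes "ac_deriv y g"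
  shows "continuous_on {0..x} y"
proof (cases "0 \<le> x")
  case True
  then have "g integrable_on {0..x}"
    using ac_derivD(1)[OF assms] set_lebesgue_integral_eq_integral(1) by blast
  then have "continuous_on {0..x} (\<lambda>t. y 0 + integral {0..t} g)"
    by (intro continuous_intros indefinite_integral_continuous_1)
  moreover have "y 0 + integral {0..t} g = y t" if "t \<in> {0..x}" for t
  proof -
    have "0 \<le> t" using that by simp
    then show ?thesis using assms unfolding ac_deriv_iff by metis
  qed
  ultimately show ?thesis
    by (rule continuous_on_eq)
qed simp

lemma ac_deriv_continuous_on_half_line:
  assumes "ac_deriv y g"
  shows "continuous_on {0..} y"
  unfolding continuous_on_eq_continuous_within
proof
  fix x :: real assume x: "x \<in> {0..}"
  have "continuous (at x within {0..x + 1}) y"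
    using ac_deriv_continuous_on[OF assms, of "x + 1"] x
    by (auto simp: continuous_on_eq_continuous_within)
  moreover have "at x within {0..x + 1} = at x within {0..}"
    by (rule at_within_nhd[of _ "{x - 1<..<x + 1}"]) auto
  ultimately show "continuous (at x within {0..}) y" by simp
qed

lemma absolutely_integrable_mult_continuous:
  fixes h u :: "real \<Rightarrow> complex"
  assumes "h absolutely_integrable_on {a..b}" "continuous_on {a..b} u"
  shows "(\<lambda>t. h t * u t) absolutely_integrable_on {a..b}"
proof -
  have "(\<lambda>t. u t * h t) absolutely_integrable_on {a..b}"
    using assms
    by (intro absolutely_integrable_bounded_measurable_product[OF bilinear_times]
          continuous_imp_measurable_on_sets_lebesgue compact_imp_bounded compact_continuous_image) auto
  then show ?thesis by (simp add: mult.commute)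
qed

text \<open>With \<open>h\<close> and \<open>w\<close> cut off to [0,x], the double integral of
  \<open>h t * w s\<close> over s \<le> t is computed in both orders. Integrating first in s gives
  the integral of \<open>h * (u - u 0)\<close>, first in t that of \<open>(G x - G) * w\<close>;
  equating the two is integration by parts, without any pointwise derivative.\<close>

lemma ac_deriv_mult:
  assumes G: "ac_deriv G h" and u: "ac_deriv u w"
  shows "ac_deriv (\<lambda>x. G x * u x) (\<lambda>x. h x * u x + G x * w x)"
  unfolding ac_deriv_iff
proof (intro allI impI conjI)
  fix x :: real assume x: "0 \<le> x"
  have ih: "h absolutely_integrable_on {0..x}" and iw: "w absolutely_integrable_on {0..x}"
    using G u x ac_derivD(1) by auto
  have ihu: "(\<lambda>t. h t * u t) absolutely_integrable_on {0..x}"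
    by (rule absolutely_integrable_mult_continuous[OF ih ac_deriv_continuous_on[OF u]])
  have iGw: "(\<lambda>t. G t * w t) absolutely_integrable_on {0..x}"
    using absolutely_integrable_mult_continuous[OF iw ac_deriv_continuous_on[OF G]]
    by (simp add: mult.commute)
  show "(\<lambda>t. h t * u t + G t * w t) absolutely_integrable_on {0..x}"
    by (rule set_integral_add(1)[OF ihu iGw])
  define H where "H = (\<lambda>t. indicator {0..x} t *\<^sub>R h t)"
  define W where "W = (\<lambda>t. indicator {0..x} t *\<^sub>R w t)"
  have HW: "integrable lebesgue H" "integrable lebesgue W"
    using ih iw by (simp_all add: H_def W_def set_integrable_def)
  have hi: "h integrable_on {0..x}" and wi: "w integrable_on {0..x}"
    using ih iw set_lebesgue_integral_eq_integral(1) by auto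
  note Gx = ac_derivD(2,3)[OF G x] and ux = ac_derivD(2,3)[OF u x]
  have inner1: "H t * (LINT s:{..t}|lebesgue. W s) = indicator {0..x} t *\<^sub>R (h t * u t - u 0 * h t)" for t
  proof (cases "t \<in> {0..x}")
    case True
    have "(LINT s:{..t}|lebesgue. W s) = (LINT s:{0..t}|lebesgue. w s)"
      unfolding set_lebesgue_integral_def W_def using True
      by (intro Bochner_Integration.integral_cong) (auto simp: indicator_def)
    also have "\<dots> = u t - u 0"
      using ac_derivD(3)[OF u] True by simp
    finally have I: "(LINT s:{..t}|lebesgue. W s) = u t - u 0" .
    show ?thesis
      unfolding I using True by (simp add: H_def algebra_simps)
  qed (simp add: H_def)
  have inner2: "W s * (LINT t:{s..}|lebesgue. H t) = indicator {0..x} s *\<^sub>R (G x * w s - G s * w s)" for s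
  proof (cases "s \<in> {0..x}")
    case True
    have "(LINT t:{s..}|lebesgue. H t) = (LINT t:{s..x}|lebesgue. h t)"
      unfolding set_lebesgue_integral_def H_def using True
      by (intro Bochner_Integration.integral_cong) (auto simp: indicator_def)
    also have "\<dots> = integral {s..x} h"
      using absolutely_integrable_on_subinterval[OF ih, of s x] True
      by (intro set_lebesgue_integral_eq_integral) auto
    also have "\<dots> = G x - G s"
    proof -
      have "integral {0..s} h + integral {s..x} h = integral {0..x} h"
        using True hi by (intro Henstock_Kurzweil_Integration.integral_combine) auto
      moreover have "G s - G 0 = integral {0..s} h"
        using ac_derivD(2)[OF G] True by simp
      ultimately show ?thesis using Gx(1) by (simp add: algebra_simps)
    qed
    finally have I: "(LINT t:{s..}|lebesgue. H t) = G x - G s" .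
    show ?thesis
      unfolding I using True by (simp add: W_def algebra_simps)
  qed (simp add: W_def)
  have "(LINT t:{0..x}|lebesgue. h t * u t - u 0 * h t) = (LINT s:{0..x}|lebesgue. G x * w s - G s * w s)"
    using lebesgue_integral_swap_triangle[OF HW, unfolded inner1 inner2]
    by (simp only: set_lebesgue_integral_def)
  moreover have "(LINT t:{0..x}|lebesgue. h t * u t - u 0 * h t)
      = (LINT t:{0..x}|lebesgue. h t * u t) - u 0 * (G x - G 0)"
    using ih ihu Gx(2) by (subst set_integral_diff(2)) auto
  moreover have "(LINT s:{0..x}|lebesgue. G x * w s - G s * w s)
      = G x * (u x - u 0) - (LINT t:{0..x}|lebesgue. G t * w t)"
    using iw iGw ux(2) by (subst set_integral_diff(2)) auto
  ultimately have "(LINT t:{0..x}|lebesgue. h t * u t)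
      = G x * (u x - u 0) - (LINT t:{0..x}|lebesgue. G t * w t) + u 0 * (G x - G 0)"
    by (metis diff_eq_eq)
  moreover have "(LINT t:{0..x}|lebesgue. h t * u t + G t * w t)
      = (LINT t:{0..x}|lebesgue. h t * u t) + (LINT t:{0..x}|lebesgue. G t * w t)"
    using ihu iGw by (rule set_integral_add(2))
  ultimately have "(LINT t:{0..x}|lebesgue. h t * u t + G t * w t) = G x * u x - G 0 * u 0"
    by (simp add: algebra_simps)
  then show "G x * u x = G 0 * u 0 + integral {0..x} (\<lambda>t. h t * u t + G t * w t)"
    using set_lebesgue_integral_eq_integral(2)[OF set_integral_add(1)[OF ihu iGw]] by simp
qed

lemma ac_deriv_add:
  assumes "ac_deriv y g" "ac_deriv u w"
  shows "ac_deriv (\<lambda>x. y x + u x) (\<lambda>x. g x + w x)"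
  unfolding ac_deriv_def
proof (intro allI impI conjI)
  fix x :: real assume x: "0 \<le> x"
  note y = ac_derivD[OF assms(1) x] and u = ac_derivD[OF assms(2) x]
  show "set_integrable lebesgue {0..x} (\<lambda>x. g x + w x)"
    by (rule set_integral_add(1)[OF y(1) u(1)])
  show "y x + u x = y 0 + u 0 + (LINT t:{0..x}|lebesgue. g t + w t)"
    by (simp add: set_integral_add(2)[OF y(1) u(1)] y(3) u(3))
qed

lemma ac_deriv_cmult:
  assumes "ac_deriv y g"
  shows "ac_deriv (\<lambda>x. c * y x) (\<lambda>x. c * g x)"
  unfolding ac_deriv_def
proof (intro allI impI conjI)
  fix x :: real assume x: "0 \<le> x"
  note y = ac_derivD[OF assms x]
  show "set_integrable lebesgue {0..x} (\<lambda>x. c * g x)"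
    using y(1) by simp
  show "c * y x = c * y 0 + (LINT t:{0..x}|lebesgue. c * g t)"
    by (simp add: y(3) right_diff_distrib)
qed

lemma ac_deriv_diff:
  assumes "ac_deriv y g" "ac_deriv u w"
  shows "ac_deriv (\<lambda>x. y x - u x) (\<lambda>x. g x - w x)"
  using ac_deriv_add[OF assms(1) ac_deriv_cmult[OF assms(2), of "-1"]] by simp

lemma ac_deriv_cnj:
  assumes "ac_deriv y g"
  shows "ac_deriv (\<lambda>x. cnj (y x)) (\<lambda>x. cnj (g x))"
  unfolding ac_deriv_def
proof (intro allI impI)
  fix x :: real assume x: "0 \<le> x"
  note y = ac_derivD[OF assms x]
  have c: "indicat_real {0..x} t *\<^sub>R cnj (g t) = cnj (indicat_real {0..x} t *\<^sub>R g t)" for t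
    by simp
  show "set_integrable lebesgue {0..x} (\<lambda>x. cnj (g x)) \<and>
        cnj (y x) = cnj (y 0) + (LINT t:{0..x}|lebesgue. cnj (g t))"
    using y(1,3) unfolding set_integrable_def set_lebesgue_integral_def c complex_integrable_cnj
    by (simp del: complex_cnj_scaleR)
qed

lemma ac_deriv_C1:
  assumes "\<And>x. (y has_vector_derivative g x) (at x)" "continuous_on UNIV g"
  shows "ac_deriv y g"
  unfolding ac_deriv_iff
proof (intro allI impI conjI)
  fix x :: real assume x: "0 \<le> x"
  show "g absolutely_integrable_on {0..x}"
    using assms(2) by (intro absolutely_integrable_continuous_real) (auto intro: continuous_on_subset)
  have "(g has_integral y x - y 0) {0..x}"
    using x assms(1) by (intro fundamental_theorem_of_calculus) (auto intro: has_vector_derivative_at_within)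
  then show "y x = y 0 + integral {0..x} g"
    by (simp add: integral_unique)
qed

text \<open>The integrals of \<open>h\<close> over all intervals in [0,\<infinity>) vanish, and by
  Lebesgue differentiation \<open>h x\<close> is almost everywhere the limit of its averages over
  intervals starting at x.\<close>

lemma ac_deriv_zero_AE:
  assumes h: "ac_deriv y h" and "\<And>x. 0 \<le> x \<Longrightarrow> y x = 0"
  shows "AE x in Rplus. h x = 0"
proof -
  \<comment> \<open>Extension by zero, since the differentiation theorem asks for integrability on
    every compact interval of the line.\<close>
  define F where "F = (\<lambda>x. if 0 \<le> x then h x else 0)"
  have int: "F integrable_on {a..b}" for a b
  proof -
    have "h integrable_on {0..b}" if "0 \<le> b"
      using ac_derivD(1)[OF h that] set_lebesgue_integral_eq_integral(1) by blast
    moreover have "{a..b} \<inter> {0..} = {max a 0..b}" by auto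
    ultimately have "h integrable_on ({a..b} \<inter> {0..})"
      by (cases "0 \<le> b") (auto intro: integrable_on_subinterval simp: integrable_on_empty)
    then have "(\<lambda>x. if x \<in> {0..} then h x else 0) integrable_on {a..b}"
      by (subst integrable_restrict_Int) (simp add: Int_commute)
    then show ?thesis by (simp add: F_def)
  qed
  have zero: "integral {a..b} F = 0" if "0 \<le> a" "a \<le> b" for a b
  proof -
    have z: "integral {0..x} F = 0" if "0 \<le> x" for x
    proof -
      have "integral {0..x} F = integral {0..x} h"
        by (rule integral_cong) (simp add: F_def)
      then show ?thesis
        using ac_derivD(2)[OF h that] assms(2) that by simp
    qed
    have "integral {0..a} F + integral {a..b} F = integral {0..b} F"
      using that int by (intro Henstock_Kurzweil_Integration.integral_combine) auto
    then show ?thesis using z that by simp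
  qed
  obtain N where N: "negligible N"
    "\<And>x e. \<lbrakk>x \<notin> N; 0 < e\<rbrakk> \<Longrightarrow> \<exists>d>0. \<forall>h. 0 < h \<and> h < d \<longrightarrow>
        norm (integral (cbox x (x + h *\<^sub>R One)) F /\<^sub>R h ^ DIM(real) - F x) < e"
    using integrable_ccontinuous_explicit[of F] int by auto
  have "h x = 0" if x: "x \<notin> N" "0 < x" for x
  proof (rule ccontr)
    assume "h x \<noteq> 0"
    then obtain d where d: "d > 0" "\<forall>k. 0 < k \<and> k < d \<longrightarrow>
        norm (integral (cbox x (x + k *\<^sub>R One)) F /\<^sub>R k ^ DIM(real) - F x) < norm (h x)"
      using N(2)[OF x(1), of "norm (h x)"] by auto
    \<comment> \<open>Any length in (0,d) would do: the average is 0, so the estimate reads |h x| <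
      |h x|.\<close>
    have "integral {x..x + d / 2} F = 0"
      using zero x d(1) by simp
    with d(2)[rule_format, of "d / 2"] d(1) show False
      using x(2) by (simp add: F_def)
  qed
  moreover have "AE x in lebesgue. x \<notin> N"
    using N(1) by (simp add: negligible_iff_null_sets AE_not_in)
  ultimately show ?thesis
    by (auto simp: AE_restrict_space_iff elim!: eventually_mono)
qed

text \<open>A non-zero value persists on an interval of positive length. The interval is taken to
  the right of x, so that x = 0 is covered as well.\<close>

lemma continuous_on_AE_zero:
  fixes y :: "real \<Rightarrow> 'a::real_normed_vector"
  assumes "continuous_on {0..} y" "AE x in Rplus. y x = 0" "0 \<le> x"
  shows "y x = 0"
proof (rule ccontr)
  assume ne: "y x \<noteq> 0"
  obtain d where d: "d > 0" "\<And>t. 0 \<le> t \<Longrightarrow> dist t x < d \<Longrightarrow> dist (y t) (y x) < norm (y x)"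
    using assms(1,3) ne unfolding continuous_on_iff by (metis atLeast_iff zero_less_norm_iff)
  have "y t \<noteq> 0" if "t \<in> {x<..<x + d}" for t
    using d(2)[of t] that assms(3) by (auto simp: dist_norm)
  moreover have "AE t in lebesgue. 0 < t \<longrightarrow> y t = 0"
    using assms(2) by (simp add: AE_restrict_space_iff)
  ultimately have "AE t in lebesgue. t \<notin> {x<..<x + d}"
    using assms(3) by (auto elim!: eventually_mono)
  then have "emeasure lebesgue {x<..<x + d} = 0"
    by (subst (asm) AE_iff_measurable[of "{x<..<x + d}"]) auto
  then show False
    using d(1) by simp
qed

section \<open>Integrals over the half-line and square-integrable functions\<close>

text \<open>Reconciles the closed intervals in \<open>ac_deriv\<close> with the open half-line of
  \<open>Rplus\<close>: they differ by the null set {0}.\<close>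

lemma Icc_Ioc_integral:
  fixes f :: "real \<Rightarrow> 'a::{banach, second_countable_topology}"
  shows "set_integrable lebesgue {0..x} f \<longleftrightarrow> set_integrable lebesgue {0<..x} f"
    and "(LINT t:{0..x}|lebesgue. f t) = (LINT t:{0<..x}|lebesgue. f t)"
  by (rule set_integrable_discrete_difference[where X = "{0}"]; force)
     (rule set_integral_discrete_difference[where X = "{0}"]; force)

lemma Icc_integral_Rplus:
  fixes f :: "real \<Rightarrow> 'a::{banach, second_countable_topology}"
  shows "(LINT t:{0..x}|lebesgue. f t) = (LINT t|Rplus. indicator {..x} t *\<^sub>R f t)"
proof -
  have "(LINT t|Rplus. indicator {..x} t *\<^sub>R f t)
      = (LINT t|lebesgue. indicator {0<..} t *\<^sub>R indicator {..x} t *\<^sub>R f t)"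
    by (rule integral_restrict_space) simp
  also have "\<dots> = (LINT t:{0<..x}|lebesgue. f t)"
    unfolding set_lebesgue_integral_def
    by (rule Bochner_Integration.integral_cong) (auto simp: indicator_def)
  finally show ?thesis by (simp add: Icc_Ioc_integral)
qed

lemma set_integrable_Icc_Rplus:
  fixes f :: "real \<Rightarrow> 'a::{banach, second_countable_topology}"
  assumes "integrable Rplus f"
  shows "set_integrable lebesgue {0..x} f"
proof -
  have "set_integrable lebesgue {0<..} f"
    using assms by (simp add: integrable_restrict_space set_integrable_def)
  then have "set_integrable lebesgue {0<..x} f"
    by (rule set_integrable_subset) auto
  then show ?thesis by (simp add: Icc_Ioc_integral)
qed

lemma tendsto_integral_Rplus:
  fixes f :: "real \<Rightarrow> 'a::{banach, second_countable_topology}"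
  assumes f: "integrable Rplus f"
  shows "((\<lambda>x. LINT t:{0..x}|lebesgue. f t) \<longlongrightarrow> integral\<^sup>L Rplus f) at_top"
  unfolding Icc_integral_Rplus
proof (rule integral_dominated_convergence_at_top[where w = "\<lambda>t. norm (f t)"])
  have m: "f \<in> borel_measurable Rplus" using f by simp
  show "f \<in> borel_measurable Rplus" by (rule m)
  show "(\<lambda>t. indicat_real {..x} t *\<^sub>R f t) \<in> borel_measurable Rplus" for x
    using m by (intro borel_measurable_scaleR measurable_restrict_space1[OF borel_measurable_indicator]) auto
  show "integrable Rplus (\<lambda>t. norm (f t))" using f by simp
  show "AE t in Rplus. ((\<lambda>x. indicat_real {..x} t *\<^sub>R f t) \<longlongrightarrow> f t) at_top"
  proof (rule AE_I2)
    fix t :: real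
    have "eventually (\<lambda>x. indicat_real {..x} t *\<^sub>R f t = f t) at_top"
      using eventually_ge_at_top[of t] by eventually_elim simp
    then show "((\<lambda>x. indicat_real {..x} t *\<^sub>R f t) \<longlongrightarrow> f t) at_top"
      by (rule tendsto_eventually)
  qed
  show "\<forall>\<^sub>F x in at_top. AE t in Rplus. norm (indicat_real {..x} t *\<^sub>R f t) \<le> norm (f t)"
    by (intro always_eventually allI AE_I2) (simp add: indicator_def)
qed

text \<open>Monotone convergence along the exhausting intervals \<open>{0<..real i}\<close>, whose
  integrals increase and are bounded by \<open>K\<close>.\<close>

lemma integrable_Rplus_of_bounded:
  fixes f :: "real \<Rightarrow> real"
  assumes int: "\<And>x. 0 \<le> x \<Longrightarrow> set_integrable lebesgue {0..x} f"
    and nonneg: "\<And>x. 0 \<le> x \<Longrightarrow> 0 \<le> f x"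
    and bound: "\<And>x. 0 \<le> x \<Longrightarrow> (LINT t:{0..x}|lebesgue. f t) \<le> K"
  shows "integrable Rplus f"
proof -
  let ?A = "\<lambda>i::nat. {0<..real i}"
  have int': "set_integrable lebesgue (?A i) f" for i
    using int[of "real i"] by (simp add: Icc_Ioc_integral)
  have "incseq (\<lambda>i. LINT t:?A i|lebesgue. f t)"
  proof (rule incseq_SucI)
    fix i
    show "(LINT t:?A i|lebesgue. f t) \<le> (LINT t:?A (Suc i)|lebesgue. f t)"
      unfolding set_lebesgue_integral_def
      using int'[of i] int'[of "Suc i"] nonneg
      by (intro integral_mono) (auto simp: set_integrable_def indicator_def)
  qed
  moreover have "(LINT t:?A i|lebesgue. f t) \<le> K" for i
    using bound[of "real i"] by (simp add: Icc_Ioc_integral)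
  ultimately obtain l where "(\<lambda>i. LINT t:?A i|lebesgue. f t) \<longlonglongrightarrow> l"
    using incseq_convergent[of "\<lambda>i. LINT t:?A i|lebesgue. f t" K] by blast
  then have "set_integrable lebesgue (\<Union>i. ?A i) f"
    using int' nonneg by (intro pos_integrable_to_top) (auto simp: mono_def)
  moreover have "(\<Union>i. ?A i) = {0<..}"
    by (auto simp: real_arch_simple)
  ultimately show ?thesis
    by (simp add: integrable_restrict_space set_integrable_def)
qed

text \<open>A non-zero limit would keep |F| above |l|/2 on intervals of arbitrary length, so the
  integral of |F| would exceed every bound.\<close>

lemma integrable_Rplus_tendsto_zero:
  fixes F :: "real \<Rightarrow> 'a::{banach, second_countable_topology}"
  assumes F: "integrable Rplus F" and lim: "(F \<longlongrightarrow> l) at_top"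
  shows "l = 0"
proof (rule ccontr)
  assume "l \<noteq> 0"
  define c where "c = norm l / 2"
  have c: "c > 0" using \<open>l \<noteq> 0\<close> by (simp add: c_def)
  have "eventually (\<lambda>x. norm (F x) > c) at_top"
    using tendsto_norm[OF lim] c by (intro order_tendstoD(1)) (auto simp: c_def)
  then obtain a where a: "\<And>x. a \<le> x \<Longrightarrow> c < norm (F x)"
    by (auto simp: eventually_at_top_linorder)
  \<comment> \<open>The maximum with 1 keeps the intervals starting at b inside the open
    half-line.\<close>
  define b where "b = max a 1"
  have b: "1 \<le> b" "a \<le> b" by (simp_all add: b_def)
  define C where "C = (LINT t|Rplus. norm (F t))"
  have "real n * c \<le> C" for n
  proof -
    have sub: "{b..b + real n} \<subseteq> {0<..}" using b by auto
    have "(LINT t|Rplus. c * indicator {b..b + real n} t) \<le> C"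
      unfolding C_def
    proof (rule integral_mono)
      show "integrable Rplus (\<lambda>t. c * indicat_real {b..b + real n} t)"
        using sub by (intro integrable_mult_right integrable_real_indicator)
           (simp_all add: sets_restrict_space_iff emeasure_restrict_space)
      show "c * indicat_real {b..b + real n} x \<le> norm (F x)" for x
        using a[of x] b by (auto simp: indicator_def)
    qed (use F in simp)
    moreover have "measure Rplus ({b..b + real n} \<inter> {0<..}) = real n"
      using sub by (subst measure_restrict_space) (simp_all add: Int_absorb2)
    ultimately show ?thesis
      by (simp add: mult.commute)
  qed
  moreover obtain n where "C / c < real n"
    using reals_Archimedean2 by blast
  ultimately show False
    using c by (metis not_less pos_divide_less_eq)
qed

section \<open>Square-integrable functions and boundary terms at infinity\<close>

lemma L2_mult_cnj_integrable:
  assumes "f \<in> L2" "g \<in> L2"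
  shows "integrable Rplus (\<lambda>x. f x * cnj (g x))"
proof (rule Bochner_Integration.integrable_bound)
  have [measurable]: "f \<in> borel_measurable Rplus" "g \<in> borel_measurable Rplus"
    using assms by (simp_all add: L2_def)
  show "integrable Rplus (\<lambda>x. (cmod (f x))\<^sup>2 + (cmod (g x))\<^sup>2)"
    using assms by (simp add: L2_def)
  show "(\<lambda>x. f x * cnj (g x)) \<in> borel_measurable Rplus"
    by (intro borel_measurable_times borel_measurable_continuous_on[where f = cnj] continuous_intros) measurable
  have "a * b \<le> a\<^sup>2 + b\<^sup>2" if "0 \<le> a * b" for a b :: real
    using that sum_squares_bound[of a b] by linarith
  then show "AE x in Rplus. norm (f x * cnj (g x)) \<le> norm ((cmod (f x))\<^sup>2 + (cmod (g x))\<^sup>2)"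
    by (intro AE_I2) (simp add: norm_mult)
qed

lemma L2_add:
  assumes "f \<in> L2" "g \<in> L2"
  shows "(\<lambda>x. f x + g x) \<in> L2"
proof -
  have m: "(\<lambda>x. f x + g x) \<in> borel_measurable Rplus"
    using assms unfolding L2_def by (intro borel_measurable_add) simp_all
  have "integrable Rplus (\<lambda>x. (cmod (f x + g x))\<^sup>2)"
  proof (rule Bochner_Integration.integrable_bound)
    show "integrable Rplus (\<lambda>x. 2 * (cmod (f x))\<^sup>2 + 2 * (cmod (g x))\<^sup>2)"
      using assms by (simp add: L2_def)
    show "(\<lambda>x. (cmod (f x + g x))\<^sup>2) \<in> borel_measurable Rplus"
      by (intro borel_measurable_power measurable_compose[OF m borel_measurable_norm])
    have "(cmod (a + b))\<^sup>2 \<le> 2 * (cmod a)\<^sup>2 + 2 * (cmod b)\<^sup>2" for a b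
    proof -
      have "(cmod (a + b))\<^sup>2 \<le> (cmod a + cmod b)\<^sup>2"
        by (intro power_mono norm_triangle_ineq) simp
      also have "\<dots> \<le> 2 * (cmod a)\<^sup>2 + 2 * (cmod b)\<^sup>2"
        using sum_squares_bound[of "cmod a" "cmod b"] by (simp add: power2_sum)
      finally show ?thesis .
    qed
    then show "AE x in Rplus. norm ((cmod (f x + g x))\<^sup>2) \<le> norm (2 * (cmod (f x))\<^sup>2 + 2 * (cmod (g x))\<^sup>2)"
      by (intro AE_I2) simp
  qed
  with m show ?thesis by (simp add: L2_def)
qed

lemma L2_cmult:
  assumes "f \<in> L2"
  shows "(\<lambda>x. c * f x) \<in> L2"
proof -
  have "(\<lambda>x. c * f x) \<in> borel_measurable Rplus"
    using assms unfolding L2_def by (intro borel_measurable_times) simp_all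
  moreover have "integrable Rplus (\<lambda>x. (cmod c)\<^sup>2 * (cmod (f x))\<^sup>2)"
    using assms unfolding L2_def by (intro integrable_mult_right) simp
  ultimately show ?thesis
    by (simp add: L2_def norm_mult power_mult_distrib)
qed

lemma L2_diff: "f \<in> L2 \<Longrightarrow> g \<in> L2 \<Longrightarrow> (\<lambda>x. f x - g x) \<in> L2"
  using L2_add[of f "\<lambda>x. - 1 * g x"] L2_cmult[of g "-1"] by simp

lemma L2_cong:
  assumes "f \<in> L2" "\<And>x. 0 < x \<Longrightarrow> f x = g x"
  shows "g \<in> L2"
proof -
  have "f \<in> borel_measurable Rplus \<longleftrightarrow> g \<in> borel_measurable Rplus"
    using assms(2) by (intro measurable_cong) simp
  moreover have "integrable Rplus (\<lambda>x. (cmod (f x))\<^sup>2) \<longleftrightarrow> integrable Rplus (\<lambda>x. (cmod (g x))\<^sup>2)"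
    using assms(2) by (intro Bochner_Integration.integrable_cong) simp_all
  ultimately show ?thesis
    using assms(1) by (simp add: L2_def)
qed

lemma ac_deriv_borel_measurable:
  assumes "ac_deriv y g"
  shows "y \<in> borel_measurable Rplus"
proof (rule continuous_imp_measurable_on_sets_lebesgue)
  show "continuous_on {0<..} y"
    using ac_deriv_continuous_on_half_line[OF assms] by (rule continuous_on_subset) auto
qed simp

lemma ac_deriv_cong:
  assumes "ac_deriv y g" "\<And>x. 0 \<le> x \<Longrightarrow> y x = u x"
  shows "ac_deriv u g"
  unfolding ac_deriv_def
proof (intro allI impI)
  fix x :: real assume x: "0 \<le> x"
  have "y x = y 0 + (LINT t:{0..x}|lebesgue. g t)" "set_integrable lebesgue {0..x} g"
    using assms(1) x unfolding ac_deriv_def by blast+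
  then show "set_integrable lebesgue {0..x} g \<and> u x = u 0 + (LINT t:{0..x}|lebesgue. g t)"
    using assms(2)[OF x] assms(2)[of 0] by simp
qed

lemma ac_deriv_cong_deriv:
  assumes "ac_deriv y g" "\<And>x. 0 \<le> x \<Longrightarrow> g x = w x"
  shows "ac_deriv y w"
  unfolding ac_deriv_def
proof (intro allI impI)
  fix x :: real assume x: "0 \<le> x"
  have "(\<lambda>t. indicat_real {0..x} t *\<^sub>R g t) = (\<lambda>t. indicat_real {0..x} t *\<^sub>R w t)"
    using assms(2) by (auto simp: indicator_def fun_eq_iff)
  then show "set_integrable lebesgue {0..x} w \<and> y x = y 0 + (LINT t:{0..x}|lebesgue. w t)"
    using assms(1) x unfolding ac_deriv_def set_integrable_def set_lebesgue_integral_def by metis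
qed

text \<open>Integrability of \<open>q\<close> gives \<open>F\<close> a limit at infinity, and
  integrability of \<open>F\<close> forces that limit to be 0. Thus boundary terms at infinity
  vanish without any decay estimate.\<close>

lemma ac_deriv_integral_eq_zero:
  assumes ac: "ac_deriv F q" and "F 0 = 0" "integrable Rplus F" "integrable Rplus q"
  shows "integral\<^sup>L Rplus q = 0"
proof -
  have "((\<lambda>x. LINT t:{0..x}|lebesgue. q t) \<longlongrightarrow> integral\<^sup>L Rplus q) at_top"
    by (rule tendsto_integral_Rplus) fact
  moreover have "eventually (\<lambda>x. (LINT t:{0..x}|lebesgue. q t) = F x) at_top"
    using eventually_ge_at_top[of 0] by eventually_elim (use ac_derivD(3)[OF ac] assms(2) in simp)
  ultimately have "(F \<longlongrightarrow> integral\<^sup>L Rplus q) at_top"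
    by (rule Lim_transform_eventually)
  then show ?thesis
    using integrable_Rplus_tendsto_zero assms(3) by blast
qed

section \<open>Symmetry of the operators\<close>

text \<open>Uniqueness of the derivative is used twice. The first derivatives agree almost
  everywhere, hence everywhere on [0,\<infinity>) by continuity; only then is their difference a
  zero function to which the second application applies.\<close>

lemma is_deriv2_unique:
  assumes "is_deriv2 y h" "is_deriv2 y h'"
  shows "AE x in Rplus. h x = h' x"
proof -
  obtain g g' where g: "ac_deriv y g" "ac_deriv g h" and g': "ac_deriv y g'" "ac_deriv g' h'"
    using assms by (auto simp: is_deriv2_def)
  have "AE x in Rplus. g x - g' x = 0"
    using ac_deriv_diff[OF g(1) g'(1)] by (rule ac_deriv_zero_AE) simp
  moreover have "continuous_on {0..} (\<lambda>x. g x - g' x)"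
    by (rule ac_deriv_continuous_on_half_line[OF ac_deriv_diff[OF g(2) g'(2)]])
  ultimately have "g x - g' x = 0" if "0 \<le> x" for x
    using that by (intro continuous_on_AE_zero[of "\<lambda>x. g x - g' x"])
  then have "AE x in Rplus. h x - h' x = 0"
    using ac_deriv_diff[OF g(2) g'(2)] by (intro ac_deriv_zero_AE)
  then show ?thesis by simp
qed

text \<open>Removes the choice in \<open>deriv2\<close>: any known second derivative may be used
  when computing with \<open>op_L\<close>.\<close>

lemma op_L_AE:
  assumes "is_deriv2 y h"
  shows "AE x in Rplus. op_L \<alpha> v k y x
           = - h x + (\<Sum>s=1..k. complex_of_real (\<alpha> s) * ip y (v s) * v s x)"
proof -
  have "is_deriv2 y (deriv2 y)"
    using someI[of "is_deriv2 y", OF assms] by (simp add: deriv2_def)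
  then have "AE x in Rplus. deriv2 y x = h x"
    using assms by (rule is_deriv2_unique)
  then show ?thesis
    by eventually_elim (simp add: op_L_def)
qed

lemma is_deriv2_add:
  assumes "is_deriv2 y h" "is_deriv2 u w"
  shows "is_deriv2 (\<lambda>x. y x + u x) (\<lambda>x. h x + w x)"
proof -
  obtain g a where "h \<in> L2" "g \<in> L2" "ac_deriv y g" "ac_deriv g h" "w \<in> L2" "a \<in> L2" "ac_deriv u a" "ac_deriv a w"
    using assms by (auto simp: is_deriv2_def)
  then have "(\<lambda>x. h x + w x) \<in> L2" "(\<lambda>x. g x + a x) \<in> L2"
      "ac_deriv (\<lambda>x. y x + u x) (\<lambda>x. g x + a x)" "ac_deriv (\<lambda>x. g x + a x) (\<lambda>x. h x + w x)"
    by (simp_all add: L2_add ac_deriv_add)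
  then show ?thesis
    unfolding is_deriv2_def by blast
qed

lemma is_deriv2_cmult:
  assumes "is_deriv2 y h"
  shows "is_deriv2 (\<lambda>x. c * y x) (\<lambda>x. c * h x)"
proof -
  obtain g where "h \<in> L2" "g \<in> L2" "ac_deriv y g" "ac_deriv g h"
    using assms by (auto simp: is_deriv2_def)
  then have "(\<lambda>x. c * h x) \<in> L2" "(\<lambda>x. c * g x) \<in> L2"
      "ac_deriv (\<lambda>x. c * y x) (\<lambda>x. c * g x)" "ac_deriv (\<lambda>x. c * g x) (\<lambda>x. c * h x)"
    by (simp_all add: L2_cmult ac_deriv_cmult)
  then show ?thesis
    unfolding is_deriv2_def by blast
qed

lemma dom_L_iff: "y \<in> dom_L \<longleftrightarrow> y \<in> L2 \<and> (\<exists>h. is_deriv2 y h) \<and> (\<forall>x\<le>0. y x = 0)"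
proof -
  have "(\<forall>x\<le>0. y x = 0) \<longleftrightarrow> (\<forall>x<0. y x = 0) \<and> y 0 = 0"
    by (metis le_less)
  then show ?thesis
    unfolding dom_L_def W22_def by blast
qed

lemma ip_add_left:
  "y \<in> L2 \<Longrightarrow> u \<in> L2 \<Longrightarrow> w \<in> L2 \<Longrightarrow> ip (\<lambda>x. y x + u x) w = ip y w + ip u w"
  using L2_mult_cnj_integrable[of y w] L2_mult_cnj_integrable[of u w]
  by (simp add: ip_def distrib_right)

lemma ip_cmult_left: "ip (\<lambda>x. c * y x) w = c * ip y w"
  by (simp add: ip_def mult.assoc)

text \<open>Pairing the equation with y and integrating by parts gives z |y|^2 = |y'|^2 + sum of
  \<alpha>_s |<y,v_s>|^2, with L2 norms. The right side is real since the \<alpha>_s are, so Im z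
  \<noteq> 0 forces |y| = 0.\<close>

lemma op_L_eigenfunction_zero:
  assumes y: "y \<in> dom_L" and eig: "AE x in Rplus. op_L \<alpha> v k y x = z * y x"
    and z: "Im z \<noteq> 0" and v: "\<And>s. s \<in> {1..k} \<Longrightarrow> v s \<in> L2"
  shows "y x = 0"
proof -
  obtain h where h: "is_deriv2 y h" and yL: "y \<in> L2" and y0: "\<And>x. x \<le> 0 \<Longrightarrow> y x = 0"
    using y by (auto simp: dom_L_iff)
  obtain g where g: "g \<in> L2" "ac_deriv y g" "ac_deriv g h" and hL: "h \<in> L2"
    using h by (auto simp: is_deriv2_def)
  have "ac_deriv (\<lambda>x. g x * cnj (y x)) (\<lambda>x. h x * cnj (y x) + g x * cnj (g x))"
    by (rule ac_deriv_mult[OF g(3) ac_deriv_cnj[OF g(2)]])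
  \<comment> \<open>The boundary term \<open>g 0 * cnj (y 0)\<close> vanishes by the Dirichlet
    condition.\<close>
  then have "(LINT x|Rplus. h x * cnj (y x) + g x * cnj (g x)) = 0"
    using L2_mult_cnj_integrable hL yL g(1) y0
    by (intro ac_deriv_integral_eq_zero[where F = "\<lambda>x. g x * cnj (y x)"]) auto
  then have hy: "ip h y = - ip g g"
    using L2_mult_cnj_integrable[OF hL yL] L2_mult_cnj_integrable[OF g(1) g(1)]
    by (simp add: ip_def eq_neg_iff_add_eq_0)
  let ?S = "\<lambda>x. \<Sum>s=1..k. complex_of_real (\<alpha> s) * ip y (v s) * (v s x * cnj (y x))"
  have iS: "integrable Rplus ?S"
    by (intro Bochner_Integration.integrable_sum integrable_mult_right L2_mult_cnj_integrable v yL)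
  have "AE x in Rplus. z * (y x * cnj (y x)) = - (h x * cnj (y x)) + ?S x"
    using eig op_L_AE[OF h, of \<alpha> v k]
  proof eventually_elim
    case (elim x)
    then have "z * y x = - h x + (\<Sum>s=1..k. complex_of_real (\<alpha> s) * ip y (v s) * v s x)"
      by (rule trans[OF sym])
    then have "z * (y x * cnj (y x))
        = (- h x + (\<Sum>s=1..k. complex_of_real (\<alpha> s) * ip y (v s) * v s x)) * cnj (y x)"
      by (simp only: mult.assoc[symmetric])
    also have "\<dots> = - (h x * cnj (y x)) + ?S x"
      by (simp only: distrib_right sum_distrib_right mult.assoc minus_mult_left)
    finally show ?case .
  qed
  then have "(LINT x|Rplus. z * (y x * cnj (y x))) = (LINT x|Rplus. - (h x * cnj (y x)) + ?S x)"
    using L2_mult_cnj_integrable[OF hL yL] L2_mult_cnj_integrable[OF yL yL] iS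
    by (intro integral_cong_AE borel_measurable_integrable) auto
  also have "\<dots> = ip g g + (\<Sum>s=1..k. complex_of_real (\<alpha> s) * ip y (v s) * ip (v s) y)"
    using L2_mult_cnj_integrable[OF hL yL] iS hy v yL
    by (simp add: Bochner_Integration.integral_sum L2_mult_cnj_integrable ip_def)
  also have "\<dots> = ip g g + (\<Sum>s=1..k. complex_of_real (\<alpha> s) * (ip y (v s) * cnj (ip y (v s))))"
  proof -
    have "ip (v s) y = cnj (ip y (v s))" for s
      unfolding ip_def Bochner_Integration.integral_cnj[symmetric] by (simp add: mult.commute)
    then show ?thesis by (simp add: mult.assoc)
  qed
  finally have "z * ip y y = \<dots>" by (simp add: ip_def)
  moreover have ip_self: "ip f f = complex_of_real (LINT x|Rplus. (cmod (f x))\<^sup>2)" for f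
    unfolding ip_def integral_complex_of_real[symmetric]
    by (rule Bochner_Integration.integral_cong) (simp_all only: complex_norm_square)
  ultimately have "z * complex_of_real (LINT x|Rplus. (cmod (y x))\<^sup>2)
      = complex_of_real ((LINT x|Rplus. (cmod (g x))\<^sup>2) + (\<Sum>s=1..k. \<alpha> s * (cmod (ip y (v s)))\<^sup>2))"
    by (simp only: ip_self complex_norm_square[symmetric] of_real_mult[symmetric] of_real_sum[symmetric]
        of_real_add[symmetric])
  then have "Im (z * complex_of_real (LINT x|Rplus. (cmod (y x))\<^sup>2)) = 0"
    by (simp only: Im_complex_of_real)
  then have "(LINT x|Rplus. (cmod (y x))\<^sup>2) = 0"
    using z by simp
  then have "AE x in Rplus. y x = 0"
    using yL by (subst (asm) integral_nonneg_eq_0_iff_AE) (auto simp: L2_def)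
  \<comment> \<open>Continuity of the representative upgrades almost everywhere to everywhere, which
    exact uniqueness of functions requires.\<close>
  then have "y x = 0" if "0 \<le> x"
    using continuous_on_AE_zero ac_deriv_continuous_on_half_line[OF g(2)] that by blast
  then show ?thesis
    using y0[of x] by (cases "0 \<le> x") auto
qed

section \<open>Existence of the resolvents\<close>

lemma set_integrable_Icc_continuous:
  fixes u :: "real \<Rightarrow> 'b::euclidean_space"
  assumes "continuous_on {0..} u"
  shows "set_integrable lebesgue {0..x} u"
  using assms by (intro absolutely_integrable_continuous_real) (rule continuous_on_subset, auto)

lemma set_integral_singleton_zero:
  fixes f :: "real \<Rightarrow> 'a::{banach, second_countable_topology}"
  shows "(LINT t:{0}|lebesgue. f t) = 0"
  using Icc_Ioc_integral(2)[of 0 f] by (simp add: set_lebesgue_integral_def)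

lemma integrable_Rplus_indicator:
  fixes f :: "real \<Rightarrow> 'a::{banach, second_countable_topology}"
  assumes f: "integrable Rplus f" and S: "S \<in> sets borel"
  shows "integrable Rplus (\<lambda>t. indicator S t *\<^sub>R f t)"
proof (rule Bochner_Integration.integrable_bound[OF f])
  show "(\<lambda>t. indicat_real S t *\<^sub>R f t) \<in> borel_measurable Rplus"
    using f S by (intro borel_measurable_scaleR measurable_restrict_space1[OF borel_measurable_indicator]) auto
qed (auto simp: indicator_def)

lemma Icc_integral_le_Rplus:
  fixes f :: "real \<Rightarrow> real"
  assumes f: "integrable Rplus f" and nonneg: "\<And>x. 0 \<le> f x"
  shows "(LINT t:{0..x}|lebesgue. f t) \<le> (LINT t|Rplus. f t)"
  unfolding Icc_integral_Rplus
proof (rule integral_mono)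
  show "integrable Rplus (\<lambda>t. indicat_real {..x} t *\<^sub>R f t)"
    by (rule integrable_Rplus_indicator[OF f]) simp
qed (use assms in \<open>auto simp: indicator_def\<close>)

text \<open>Energy estimate: \<open>(|A|\<^sup>2)' = 2 Re c |A|\<^sup>2 + 2 Re (f cnj A)\<close>, where the last term is absorbed by
  the inequality between arithmetic and geometric mean.\<close>

lemma L2_of_bounded_solution:
  assumes ac: "ac_deriv A (\<lambda>x. c * A x + f x)" and c: "Re c \<noteq> 0" and f: "f \<in> L2"
    and bound: "\<And>x. 0 \<le> x \<Longrightarrow> cmod (A x) \<le> C"
  shows "A \<in> L2"
proof -
  define a where "a = Re c"
  define N where "N = (\<lambda>x. (cmod (A x))\<^sup>2)"
  define M where "M = (\<lambda>x. (cmod (f x))\<^sup>2)"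
  define q where "q = (\<lambda>x. 2 * Re ((c * A x + f x) * cnj (A x)))"
  have N_sq: "A x * cnj (A x) = complex_of_real (N x)" for x
    unfolding N_def complex_norm_square ..
  have "(c * A x + f x) * cnj (A x) + A x * cnj (c * A x + f x) = complex_of_real (q x)" for x
    unfolding q_def using complex_add_cnj[of "(c * A x + f x) * cnj (A x)"]
    by (simp add: mult.commute)
  then have acN: "ac_deriv (\<lambda>x. complex_of_real (N x)) (\<lambda>x. complex_of_real (q x))"
    using ac_deriv_mult[OF ac ac_deriv_cnj[OF ac]] unfolding N_sq by simp
  have contN: "continuous_on {0..} N"
    unfolding N_def by (intro continuous_intros ac_deriv_continuous_on_half_line[OF ac])
  have intN: "set_integrable lebesgue {0..x} N" for x
    by (rule set_integrable_Icc_continuous[OF contN])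
  have M_Rplus: "integrable Rplus M"
    using f by (simp add: L2_def M_def)
  have intM: "set_integrable lebesgue {0..x} M" for x
    by (rule set_integrable_Icc_Rplus[OF M_Rplus])
  \<comment> \<open>The bound that results from integrating \<open>pointwise\<close> below over
    [0,x], with \<open>sgn a * (N x - N 0)\<close> at most \<open>C^2\<close>, and dividing by
    |a|.\<close>
  define K where "K = (C\<^sup>2 + (LINT t|Rplus. M t) / \<bar>a\<bar>) / \<bar>a\<bar>"
  have a0: "\<bar>a\<bar> > 0" using c by (simp add: a_def)
  \<comment> \<open>The factor \<open>sgn a\<close> treats growing and decaying equations at once.
    The weight |a| in 2|f||A| \<le> |f|^2/|a| + |a||A|^2 uses up only half of the term
    2|a||A|^2.\<close>
  have pointwise: "\<bar>a\<bar> * N x - M x / \<bar>a\<bar> \<le> sgn a * q x" for x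
  proof -
    define P where "P = Re (f x * cnj (A x))"
    have q: "q x = 2 * a * N x + 2 * P"
    proof -
      have "(c * A x + f x) * cnj (A x) = c * complex_of_real (N x) + f x * cnj (A x)"
        unfolding N_sq[symmetric] by (simp add: distrib_right mult.assoc)
      then show ?thesis
        unfolding q_def P_def a_def by (simp only:) simp
    qed
    have "\<bar>P\<bar> \<le> cmod (f x) * cmod (A x)"
      unfolding P_def using abs_Re_le_cmod[of "f x * cnj (A x)"] by (simp add: norm_mult)
    moreover have "2 * (cmod (f x) * cmod (A x)) \<le> M x / \<bar>a\<bar> + \<bar>a\<bar> * N x"
    proof -
      have "0 \<le> (cmod (f x) - \<bar>a\<bar> * cmod (A x))\<^sup>2 / \<bar>a\<bar>" using a0 by simp
      also have "\<dots> = M x / \<bar>a\<bar> + \<bar>a\<bar> * N x - 2 * (cmod (f x) * cmod (A x))"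
        using a0 by (simp add: M_def N_def power2_diff field_simps power2_eq_square)
      finally show ?thesis by simp
    qed
    moreover have "sgn a * q x = 2 * (\<bar>a\<bar> * N x) + 2 * (sgn a * P)"
      unfolding q by (simp add: algebra_simps abs_sgn)
    moreover have "- \<bar>P\<bar> \<le> sgn a * P"
      using a0 by (auto simp: sgn_real_def)
    ultimately show ?thesis by linarith
  qed
  have "integrable Rplus N"
  proof (rule integrable_Rplus_of_bounded[where K = K])
    fix x :: real assume x: "0 \<le> x"
    show "set_integrable lebesgue {0..x} N" by (rule intN)
    show "0 \<le> N x" by (simp add: N_def)
    have intq: "set_integrable lebesgue {0..x} q"
      using ac_derivD(1)[OF acN x]
      unfolding set_integrable_def scaleR_conv_of_real of_real_mult[symmetric] complex_of_real_integrable_eq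
      by simp
    have "complex_of_real (LINT t:{0..x}|lebesgue. q t) = complex_of_real (N x - N 0)"
      using ac_derivD(3)[OF acN x] by (simp add: set_integral_complex_of_real)
    then have Iq: "(LINT t:{0..x}|lebesgue. q t) = N x - N 0"
      by (simp only: of_real_eq_iff)
    have int1: "set_integrable lebesgue {0..x} (\<lambda>t. \<bar>a\<bar> * N t)"
      and int2: "set_integrable lebesgue {0..x} (\<lambda>t. M t / \<bar>a\<bar>)"
      and int3: "set_integrable lebesgue {0..x} (\<lambda>t. sgn a * q t)"
      using intN intM intq by simp_all
    have "\<bar>a\<bar> * (LINT t:{0..x}|lebesgue. N t) - (LINT t:{0..x}|lebesgue. M t) / \<bar>a\<bar>
        = (LINT t:{0..x}|lebesgue. \<bar>a\<bar> * N t - M t / \<bar>a\<bar>)"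
      by (simp add: set_integral_diff(2)[OF int1 int2])
    also have "\<dots> \<le> (LINT t:{0..x}|lebesgue. sgn a * q t)"
      using pointwise by (intro set_integral_mono set_integral_diff(1) int1 int2 int3)
    also have "\<dots> = sgn a * (N x - N 0)"
      using Iq by simp
    also have "\<dots> \<le> C\<^sup>2"
    proof -
      have "0 \<le> C" using bound[OF x] norm_ge_zero order_trans by blast
      then have "N x \<le> C\<^sup>2" "N 0 \<le> C\<^sup>2" "0 \<le> N x" "0 \<le> N 0"
        using bound[OF x] bound[of 0] by (simp_all add: N_def power_mono)
      then show ?thesis by (auto simp: sgn_real_def)
    qed
    finally have "\<bar>a\<bar> * (LINT t:{0..x}|lebesgue. N t) \<le> C\<^sup>2 + (LINT t:{0..x}|lebesgue. M t) / \<bar>a\<bar>"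
      by simp
    also have "\<dots> \<le> C\<^sup>2 + (LINT t|Rplus. M t) / \<bar>a\<bar>"
      using Icc_integral_le_Rplus[OF M_Rplus] a0 by (simp add: M_def divide_right_mono)
    finally show "(LINT t:{0..x}|lebesgue. N t) \<le> K"
      using a0 by (simp add: K_def pos_le_divide_eq mult.commute)
  qed
  moreover have "A \<in> borel_measurable Rplus"
    by (rule ac_deriv_borel_measurable[OF ac])
  ultimately show ?thesis
    by (simp add: L2_def N_def)
qed

section \<open>Bounded solutions of first-order equations and the free resolvent\<close>

lemma ac_deriv_exp:
  "ac_deriv (\<lambda>x. exp (c * complex_of_real x)) (\<lambda>x. c * exp (c * complex_of_real x))"
proof (rule ac_deriv_C1)
  show "((\<lambda>x. exp (c * complex_of_real x)) has_vector_derivative c * exp (c * complex_of_real x)) (at x)" for x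
    by (rule has_vector_derivative_real_field) (auto intro!: derivative_eq_intros)
qed (intro continuous_intros)

lemma ac_deriv_indefinite_integral:
  assumes "\<And>x. 0 \<le> x \<Longrightarrow> set_integrable lebesgue {0..x} f"
  shows "ac_deriv (\<lambda>x. c + (LINT t:{0..x}|lebesgue. f t)) f"
proof -
  have "(LINT t:{0..0}|lebesgue. f t) = 0"
    by (simp add: set_integral_singleton_zero)
  with assms show ?thesis
    by (simp add: ac_deriv_def)
qed

lemma ac_deriv_variation_of_constants:
  assumes f: "integrable Rplus f"
  shows "ac_deriv (\<lambda>x. exp (c * complex_of_real x) *
            (a + (LINT t:{0..x}|lebesgue. exp (- (c * complex_of_real t)) * f t)))
          (\<lambda>x. c * (exp (c * complex_of_real x) *
            (a + (LINT t:{0..x}|lebesgue. exp (- (c * complex_of_real t)) * f t))) + f x)"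
proof -
  have "(\<lambda>t. f t * exp (- (c * complex_of_real t))) absolutely_integrable_on {0..x}" for x
    by (intro absolutely_integrable_mult_continuous set_integrable_Icc_Rplus f continuous_intros)
  then have "ac_deriv (\<lambda>x. a + (LINT t:{0..x}|lebesgue. exp (- (c * complex_of_real t)) * f t))
      (\<lambda>t. exp (- (c * complex_of_real t)) * f t)"
    by (intro ac_deriv_indefinite_integral) (simp add: mult.commute)
  from ac_deriv_mult[OF ac_deriv_exp[of c] this] show ?thesis
    by (rule ac_deriv_cong_deriv) (simp add: mult.assoc exp_minus)
qed

text \<open>On \<open>S\<close> the kernel \<open>exp (c * (x - t))\<close> has modulus at most 1.
  The set is \<open>{..x}\<close> for decaying and \<open>{x<..}\<close> for growing
  exponentials.\<close>

lemma norm_exp_integral_le: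
  assumes f: "integrable Rplus f" and S: "S \<in> sets borel"
    and "\<And>t. t \<in> S \<Longrightarrow> 0 < t \<Longrightarrow> Re c * (x - t) \<le> 0"
  shows "cmod (exp (c * complex_of_real x) *
           (LINT t|Rplus. indicator S t *\<^sub>R (exp (- (c * complex_of_real t)) * f t)))
         \<le> (LINT t|Rplus. cmod (f t))"
proof -
  let ?F = "\<lambda>t. exp (c * complex_of_real x) * (indicat_real S t *\<^sub>R (exp (- (c * complex_of_real t)) * f t))"
  have F: "cmod (?F t) \<le> cmod (f t)" if "0 < t" for t
  proof (cases "t \<in> S")
    case True
    then have "?F t = exp (c * complex_of_real (x - t)) * f t"
      by (simp add: right_diff_distrib exp_diff exp_minus divide_inverse)
    then have "cmod (?F t) = exp (Re c * (x - t)) * cmod (f t)"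
      by (simp add: norm_mult)
    also have "\<dots> \<le> cmod (f t)"
      using assms(3)[OF True that] by (intro mult_left_le_one_le) simp_all
    finally show ?thesis .
  qed simp
  have int: "integrable Rplus ?F"
  proof (rule Bochner_Integration.integrable_bound[OF f])
    have "(\<lambda>t. exp (- (c * complex_of_real t))) \<in> borel_measurable Rplus"
      by (intro continuous_imp_measurable_on_sets_lebesgue continuous_intros) simp
    moreover have "f \<in> borel_measurable Rplus" using f by simp
    ultimately show "?F \<in> borel_measurable Rplus"
      using S by (intro borel_measurable_times borel_measurable_const borel_measurable_scaleR
          measurable_restrict_space1[OF borel_measurable_indicator]) auto
    show "AE t in Rplus. cmod (?F t) \<le> cmod (f t)"
      using F by (intro AE_I2) simp
  qed
  have "cmod (LINT t|Rplus. ?F t) \<le> (LINT t|Rplus. cmod (?F t))"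
    by (rule integral_norm_bound)
  also have "\<dots> \<le> (LINT t|Rplus. cmod (f t))"
    using F by (intro integral_mono integrable_norm int f) simp
  finally show ?thesis
    by (simp only: integral_mult_right_zero)
qed

text \<open>Here every solution is bounded, so the initial value stays free; it serves later to meet
  the Dirichlet condition.\<close>

lemma bounded_solution_decaying:
  assumes f: "integrable Rplus f" and c: "Re c < 0"
  obtains A C where "A 0 = a" "ac_deriv A (\<lambda>x. c * A x + f x)" "\<And>x. 0 \<le> x \<Longrightarrow> cmod (A x) \<le> C"
proof -
  let ?A = "\<lambda>x. exp (c * complex_of_real x) *
            (a + (LINT t:{0..x}|lebesgue. exp (- (c * complex_of_real t)) * f t))"
  have "?A 0 = a"
    by (simp add: set_integral_singleton_zero)
  moreover have "ac_deriv ?A (\<lambda>x. c * ?A x + f x)"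
    by (rule ac_deriv_variation_of_constants[OF f])
  moreover have "cmod (?A x) \<le> cmod a + (LINT t|Rplus. cmod (f t))" if x: "0 \<le> x" for x
  proof -
    have "cmod (exp (c * complex_of_real x) * a) \<le> cmod a"
      using c x by (simp add: norm_mult mult_left_le_one_le mult_nonpos_nonneg)
    moreover have "cmod (exp (c * complex_of_real x) *
           (LINT t|Rplus. indicator {..x} t *\<^sub>R (exp (- (c * complex_of_real t)) * f t)))
         \<le> (LINT t|Rplus. cmod (f t))"
      using c by (intro norm_exp_integral_le[OF f]) (simp_all add: mult_nonpos_nonneg)
    ultimately show ?thesis
      unfolding Icc_integral_Rplus distrib_left by (rule norm_triangle_mono)
  qed
  ultimately show ?thesis
    by (rule that[of ?A])
qed

text \<open>Boundedness now dictates the initial value: minus the full integral, which turns the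
  integral over [0,x] into minus the integral over (x,\<infinity>).\<close>

lemma bounded_solution_growing:
  assumes f: "integrable Rplus f" and c: "0 < Re c"
  obtains A C where "ac_deriv A (\<lambda>x. c * A x + f x)" "\<And>x. 0 \<le> x \<Longrightarrow> cmod (A x) \<le> C"
proof
  let ?F = "\<lambda>t. exp (- (c * complex_of_real t)) * f t"
  let ?A = "\<lambda>x. exp (c * complex_of_real x) * (- (LINT t|Rplus. ?F t) + (LINT t:{0..x}|lebesgue. ?F t))"
  show "ac_deriv ?A (\<lambda>x. c * ?A x + f x)"
    by (rule ac_deriv_variation_of_constants[OF f])
  have F: "integrable Rplus ?F"
  proof (rule Bochner_Integration.integrable_bound[OF f])
    have "(\<lambda>t. exp (- (c * complex_of_real t))) \<in> borel_measurable Rplus"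
      by (intro continuous_imp_measurable_on_sets_lebesgue continuous_intros) simp
    moreover have "f \<in> borel_measurable Rplus" using f by simp
    ultimately show "?F \<in> borel_measurable Rplus"
      by (intro borel_measurable_times)
    show "AE t in Rplus. cmod (?F t) \<le> cmod (f t)"
      using c by (intro AE_I2) (simp add: norm_mult mult_left_le_one_le)
  qed
  show "cmod (?A x) \<le> (LINT t|Rplus. cmod (f t))" if "0 \<le> x" for x
  proof -
    have "(LINT t|Rplus. ?F t) = (LINT t|Rplus. indicator {..x} t *\<^sub>R ?F t + indicator {x<..} t *\<^sub>R ?F t)"
      by (rule Bochner_Integration.integral_cong) (auto simp: indicator_def)
    also have "\<dots> = (LINT t|Rplus. indicator {..x} t *\<^sub>R ?F t) + (LINT t|Rplus. indicator {x<..} t *\<^sub>R ?F t)"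
      by (intro Bochner_Integration.integral_add integrable_Rplus_indicator F) simp_all
    finally have "?A x = - (exp (c * complex_of_real x) * (LINT t|Rplus. indicator {x<..} t *\<^sub>R ?F t))"
      by (simp add: Icc_integral_Rplus)
    then have "cmod (?A x) = cmod (exp (c * complex_of_real x) * (LINT t|Rplus. indicator {x<..} t *\<^sub>R ?F t))"
      by (simp only: norm_minus_cancel)
    also have "\<dots> \<le> (LINT t|Rplus. cmod (f t))"
      using c by (intro norm_exp_integral_le[OF f]) (simp_all add: mult_nonneg_nonpos)
    finally show ?thesis .
  qed
qed

text \<open>The equation -y'' - \<mu>^2 y = f splits into two first-order equations with
  coefficients i\<mu> and -i\<mu>, whose real parts are -Im \<mu> < 0 and Im \<mu> > 0.
  \<open>B\<close> is built first, because its initial value is dictated, and \<open>A\<close> is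
  then given the value \<open>- B 0\<close>. Integrability of \<open>f\<close> makes both bounded,
  and the energy estimate puts them into L2.\<close>

lemma free_resolvent_exists:
  assumes f: "f \<in> L2" "integrable Rplus f" and \<mu>: "0 < Im \<mu>"
  obtains y where "y \<in> dom_L" "AE x in Rplus. op_L \<alpha> v 0 y x - \<mu>\<^sup>2 * y x = f x"
proof -
  have \<mu>0: "\<mu> \<noteq> 0" using \<mu> by auto
  obtain B C where B: "ac_deriv B (\<lambda>x. - (\<i> * \<mu>) * B x + - f x)" "\<And>x. 0 \<le> x \<Longrightarrow> cmod (B x) \<le> C"
    using bounded_solution_growing[of "\<lambda>x. - f x" "- (\<i> * \<mu>)"] f(2) \<mu> by auto
  obtain A D where A: "A 0 = - B 0" "ac_deriv A (\<lambda>x. (\<i> * \<mu>) * A x + f x)" "\<And>x. 0 \<le> x \<Longrightarrow> cmod (A x) \<le> D"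
    using bounded_solution_decaying[of f "\<i> * \<mu>" "- B 0"] f(2) \<mu> by auto
  have mf: "(\<lambda>x. - f x) \<in> L2" using L2_cmult[OF f(1), of "-1"] by simp
  have BL: "B \<in> L2"
    using \<mu> by (intro L2_of_bounded_solution[OF B(1) _ mf B(2)]) simp
  have AL: "A \<in> L2"
    using \<mu> by (intro L2_of_bounded_solution[OF A(2) _ f(1) A(3)]) simp
  \<comment> \<open>\<open>w\<close> is the solution and \<open>g\<close> its derivative: the source
    f cancels in A' + B' and doubles in A' - B', whence the factors i/(2\<mu>) and -1/2.\<close>
  define w where "w = (\<lambda>x. \<i> / (2 * \<mu>) * (A x + B x))"
  define g where "g = (\<lambda>x. - (1 / 2) * (A x - B x))"
  \<comment> \<open>The normalization on the negative half-line demanded by \<open>W22\<close>; at 0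
    it agrees with \<open>w\<close> because \<open>A 0 = - B 0\<close>.\<close>
  define y where "y = (\<lambda>x. if x \<le> 0 then 0 else w x)"
  define h where "h = (\<lambda>x. - \<mu>\<^sup>2 * w x - f x)"
  have wL: "w \<in> L2" unfolding w_def by (intro L2_cmult L2_add AL BL)
  have gL: "g \<in> L2" unfolding g_def by (intro L2_cmult L2_diff AL BL)
  have hL: "h \<in> L2" unfolding h_def by (intro L2_cmult L2_diff wL f(1))
  have "ac_deriv w g"
    unfolding w_def using ac_deriv_cmult[OF ac_deriv_add[OF A(2) B(1)]]
    by (rule ac_deriv_cong_deriv) (use \<mu>0 in \<open>simp add: g_def field_simps\<close>)
  then have yg: "ac_deriv y g"
    by (rule ac_deriv_cong) (simp add: y_def w_def A(1))
  have gh: "ac_deriv g h"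
    unfolding g_def using ac_deriv_cmult[OF ac_deriv_diff[OF A(2) B(1)]]
    by (rule ac_deriv_cong_deriv) (use \<mu>0 in \<open>simp add: h_def w_def field_simps power2_eq_square\<close>)
  have h: "is_deriv2 y h"
    unfolding is_deriv2_def using hL gL yg gh by blast
  have "y \<in> L2"
    using wL by (rule L2_cong) (simp add: y_def)
  then have "y \<in> dom_L"
    using h by (auto simp: dom_L_iff y_def)
  moreover have "AE x in Rplus. op_L \<alpha> v 0 y x - \<mu>\<^sup>2 * y x = f x"
  proof -
    have "AE x in Rplus. 0 < x"
      by (rule AE_I2) simp
    with op_L_AE[OF h, of \<alpha> v 0] show ?thesis
      by eventually_elim (simp add: h_def y_def)
  qed
  ultimately show ?thesis by (rule that)
qed

section \<open>Rank-one perturbation and well-definedness of the resolvents\<close>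

lemma dom_L_lincomb:
  assumes "y \<in> dom_L" "u \<in> dom_L"
  shows "(\<lambda>x. y x + c * u x) \<in> dom_L"
proof -
  obtain h w where "is_deriv2 y h" "is_deriv2 u w"
    using assms by (auto simp: dom_L_iff)
  then have "is_deriv2 (\<lambda>x. y x + c * u x) (\<lambda>x. h x + c * w x)"
    by (intro is_deriv2_add is_deriv2_cmult)
  moreover have "(\<lambda>x. y x + c * u x) \<in> L2"
    using assms by (intro L2_add L2_cmult) (auto simp: dom_L_iff)
  ultimately show ?thesis
    using assms by (auto simp: dom_L_iff)
qed

text \<open>The identity is only almost everywhere, since \<open>deriv2\<close> chooses a second
  derivative for each function separately.\<close>

lemma op_L_lincomb_AE:
  assumes y: "y \<in> dom_L" and u: "u \<in> dom_L" and v: "\<And>s. s \<in> {1..k} \<Longrightarrow> v s \<in> L2"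
  shows "AE x in Rplus. op_L \<alpha> v k (\<lambda>x. y x + c * u x) x = op_L \<alpha> v k y x + c * op_L \<alpha> v k u x"
proof -
  obtain h w where hw: "is_deriv2 y h" "is_deriv2 u w"
    using y u by (auto simp: dom_L_iff)
  have L: "y \<in> L2" "(\<lambda>x. c * u x) \<in> L2"
    using y u by (auto simp: dom_L_iff intro: L2_cmult)
  have ip: "ip (\<lambda>x. y x + c * u x) (v s) = ip y (v s) + c * ip u (v s)" if "s \<in> {1..k}" for s
    using ip_add_left[OF L v[OF that]] by (simp add: ip_cmult_left)
  have sum: "(\<Sum>s=1..k. complex_of_real (\<alpha> s) * ip (\<lambda>x. y x + c * u x) (v s) * v s x)
      = (\<Sum>s=1..k. complex_of_real (\<alpha> s) * ip y (v s) * v s x)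
        + c * (\<Sum>s=1..k. complex_of_real (\<alpha> s) * ip u (v s) * v s x)" for x
    unfolding sum_distrib_left sum.distrib[symmetric]
    by (rule sum.cong) (auto simp: ip algebra_simps)
  show ?thesis
    using op_L_AE[OF hw(1), of \<alpha> v k] op_L_AE[OF hw(2), of \<alpha> v k]
      op_L_AE[OF is_deriv2_add[OF hw(1) is_deriv2_cmult[OF hw(2)]], of \<alpha> v k c]
  proof eventually_elim
    case (elim x)
    show ?case
      unfolding elim sum by (simp add: algebra_simps)
  qed
qed

lemma op_L_Suc:
  "op_L \<alpha> v (Suc k) y x
     = op_L \<alpha> v k y x + complex_of_real (\<alpha> (Suc k)) * ip y (v (Suc k)) * v (Suc k) x"
  by (simp add: op_L_def)

text \<open>Induction on k with f arbitrary, because the step solves the equation for both f and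
  \<open>v (Suc k)\<close>. Integrability is carried along with membership in \<open>L2\<close>, as
  variation of constants in the base case relies on it.\<close>

lemma resolvent_equation_solvable:
  assumes v: "\<And>s. s \<in> {1..k} \<Longrightarrow> v s \<in> L2 \<and> integrable Rplus (v s)"
    and f: "f \<in> L2" "integrable Rplus f" and \<mu>: "0 < Im \<mu>" "Im (\<mu>\<^sup>2) \<noteq> 0"
  shows "\<exists>y\<in>dom_L. AE x in Rplus. op_L \<alpha> v k y x - \<mu>\<^sup>2 * y x = f x"
  using v f
proof (induction k arbitrary: f)
  case 0
  then show ?case
    using free_resolvent_exists[of f \<mu> \<alpha> v] \<mu>(1) by metis
next
  case (Suc k)
  let ?u = "v (Suc k)" and ?a = "complex_of_real (\<alpha> (Suc k))"
  have v: "v s \<in> L2 \<and> integrable Rplus (v s)" if "s \<in> {1..Suc k}" for s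
    using Suc.prems(1) that .
  obtain p where p: "p \<in> dom_L" "AE x in Rplus. op_L \<alpha> v k p x - \<mu>\<^sup>2 * p x = f x"
    using Suc.IH[of f] Suc.prems by auto
  obtain r where r: "r \<in> dom_L" "AE x in Rplus. op_L \<alpha> v k r x - \<mu>\<^sup>2 * r x = ?u x"
    using Suc.IH[of ?u] v by auto
  \<comment> \<open>The denominator of the rank-one update, that is, b_{k+1} at the point
    \<mu>^2.\<close>
  define D where "D = 1 + ?a * ip r ?u"
  have "D \<noteq> 0"
  proof
    assume D: "D = 0"
    \<comment> \<open>If \<open>D = 0\<close>, then \<open>r\<close> is an eigenfunction for a
      non-real eigenvalue, hence zero; but then \<open>D = 1\<close>.\<close>
    have "AE x in Rplus. op_L \<alpha> v (Suc k) r x = \<mu>\<^sup>2 * r x"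
      using r(2)
    proof eventually_elim
      case (elim x)
      have "op_L \<alpha> v (Suc k) r x = \<mu>\<^sup>2 * r x + D * ?u x"
        using elim by (simp add: op_L_Suc D_def algebra_simps)
      then show ?case using D by simp
    qed
    then have "r x = 0" for x
      using op_L_eigenfunction_zero[OF r(1) _ \<mu>(2)] v by blast
    then have "ip r ?u = 0"
      by (simp add: ip_def)
    with D show False by (simp add: D_def)
  qed
  \<comment> \<open>Chosen so that the total coefficient of \<open>v (Suc k)\<close> produced by
    \<open>p + c * r\<close>, namely \<open>c + ?a * ip ?y ?u\<close>, vanishes.\<close>
  define c where "c = - (?a * ip p ?u) / D"
  let ?y = "\<lambda>x. p x + c * r x"
  have ip: "ip ?y ?u = ip p ?u + c * ip r ?u"
    using ip_add_left[of p "\<lambda>x. c * r x" ?u] p(1) r(1) v[of "Suc k"]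
    by (simp add: ip_cmult_left L2_cmult dom_L_iff)
  have "c * D + ?a * ip p ?u = 0"
    using \<open>D \<noteq> 0\<close> by (simp add: c_def)
  then have c: "c + ?a * ip ?y ?u = 0"
    unfolding ip D_def by (simp add: algebra_simps)
  have "AE x in Rplus. op_L \<alpha> v k ?y x = op_L \<alpha> v k p x + c * op_L \<alpha> v k r x"
    using v by (intro op_L_lincomb_AE[OF p(1) r(1)]) auto
  with p(2) r(2) have "AE x in Rplus. op_L \<alpha> v (Suc k) ?y x - \<mu>\<^sup>2 * ?y x = f x"
  proof eventually_elim
    case (elim x)
    have "op_L \<alpha> v (Suc k) ?y x - \<mu>\<^sup>2 * ?y x
        = (op_L \<alpha> v k p x - \<mu>\<^sup>2 * p x) + c * (op_L \<alpha> v k r x - \<mu>\<^sup>2 * r x) + ?a * ip ?y ?u * ?u x"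
      unfolding op_L_Suc elim(3) by (simp add: algebra_simps)
    also have "\<dots> = f x + (c + ?a * ip ?y ?u) * ?u x"
      unfolding elim(1,2) by (simp add: algebra_simps)
    finally show ?case using c by simp
  qed
  then show ?case
    using dom_L_lincomb[OF p(1) r(1), of c] by blast
qed

text \<open>Makes the definite description in \<open>resolvent\<close> meaningful. Solutions are
  unique as functions, not merely almost everywhere, because elements of \<open>dom_L\<close> are
  continuous on [0,\<infinity>) and zero to the left of it.\<close>

lemma resolvent_in_dom_L:
  assumes v: "\<And>s. s \<in> {1..k} \<Longrightarrow> v s \<in> L2 \<and> integrable Rplus (v s)"
    and f: "f \<in> L2" "integrable Rplus f" and \<mu>: "0 < Im \<mu>" "Im (\<mu>\<^sup>2) \<noteq> 0"
  shows "resolvent \<alpha> v k (\<mu>\<^sup>2) f \<in> dom_L"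
proof -
  let ?P = "\<lambda>y. y \<in> dom_L \<and> (AE x in Rplus. op_L \<alpha> v k y x - \<mu>\<^sup>2 * y x = f x)"
  have "\<exists>!y. ?P y"
  proof (rule ex_ex1I)
    have "\<exists>y\<in>dom_L. AE x in Rplus. op_L \<alpha> v k y x - \<mu>\<^sup>2 * y x = f x"
      by (rule resolvent_equation_solvable[OF v f \<mu>])
    then show "\<exists>y. ?P y" by blast
    fix y u assume y: "?P y" and u: "?P u"
    let ?d = "\<lambda>x. y x + - 1 * u x"
    have "AE x in Rplus. op_L \<alpha> v k ?d x = op_L \<alpha> v k y x + - 1 * op_L \<alpha> v k u x"
      using v y u by (intro op_L_lincomb_AE) auto
    moreover have "AE x in Rplus. op_L \<alpha> v k y x - \<mu>\<^sup>2 * y x = f x"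
      "AE x in Rplus. op_L \<alpha> v k u x - \<mu>\<^sup>2 * u x = f x"
      using y u by auto
    ultimately have "AE x in Rplus. op_L \<alpha> v k ?d x = \<mu>\<^sup>2 * ?d x"
      by eventually_elim (simp add: algebra_simps)
    then have "?d x = 0" for x
      using v y u \<mu>(2) dom_L_lincomb[of y u "-1"] by (intro op_L_eigenfunction_zero) auto
    then show "y = u"
      by (simp add: fun_eq_iff)
  qed
  from theI'[OF this] show ?thesis
    by (simp add: resolvent_def)
qed

text \<open>For integrability of \<open>f\<close> itself: where |f| exceeds 1/(1+x^2), one has
  (1+x^2)|f| \<ge> 1 and thus |f| \<le> (1+x^2)|f|^2. So |f| is bounded by the sum of two integrable
  functions.\<close>

lemma weighted_L2_imp_L1_L2:
  assumes m: "f \<in> borel_measurable Rplus" and int: "integrable Rplus (\<lambda>x. (1 + x\<^sup>2) * (cmod (f x))\<^sup>2)"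
  shows "f \<in> L2 \<and> integrable Rplus f"
proof
  have "integrable Rplus (\<lambda>x. (cmod (f x))\<^sup>2)"
  proof (rule Bochner_Integration.integrable_bound[OF int])
    show "(\<lambda>x. (cmod (f x))\<^sup>2) \<in> borel_measurable Rplus"
      by (intro borel_measurable_power measurable_compose[OF m borel_measurable_norm])
    show "AE x in Rplus. norm ((cmod (f x))\<^sup>2) \<le> norm ((1 + x\<^sup>2) * (cmod (f x))\<^sup>2)"
      by (intro AE_I2) (simp add: abs_mult mult_le_cancel_right1)
  qed
  with m show "f \<in> L2" by (simp add: L2_def)
  \<comment> \<open>The primitive is arctan, bounded by pi/2.\<close>
  have weight: "integrable Rplus (\<lambda>x. inverse (1 + x\<^sup>2))"
  proof (rule integrable_Rplus_of_bounded[where K = "pi / 2"])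
    fix x :: real assume x: "0 \<le> x"
    have "1 + t\<^sup>2 \<noteq> 0" for t :: real
      by (smt (verit) zero_le_power2)
    then show int: "set_integrable lebesgue {0..x} (\<lambda>x. inverse (1 + x\<^sup>2))"
      by (intro absolutely_integrable_continuous_real continuous_intros) auto
    have "((\<lambda>x. inverse (1 + x\<^sup>2)) has_integral arctan x - arctan 0) {0..x}"
      using x by (intro fundamental_theorem_of_calculus)
        (auto simp flip: has_real_derivative_iff_has_vector_derivative intro!: derivative_eq_intros)
    then have "(LINT t:{0..x}|lebesgue. inverse (1 + t\<^sup>2)) = arctan x"
      using set_lebesgue_integral_eq_integral(2)[OF int] by (simp add: integral_unique)
    then show "(LINT t:{0..x}|lebesgue. inverse (1 + t\<^sup>2)) \<le> pi / 2"
      using arctan_ubound[of x] by simp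
  qed simp
  show "integrable Rplus f"
  proof (rule Bochner_Integration.integrable_bound)
    show "integrable Rplus (\<lambda>x. inverse (1 + x\<^sup>2) + (1 + x\<^sup>2) * (cmod (f x))\<^sup>2)"
      using weight int by simp
    have "cmod (f x) \<le> inverse (1 + x\<^sup>2) + (1 + x\<^sup>2) * (cmod (f x))\<^sup>2" for x
    proof (cases "cmod (f x) \<le> inverse (1 + x\<^sup>2)")
      case False
      have pos: "0 < 1 + x\<^sup>2" by (smt (verit) zero_le_power2)
      with False have "1 \<le> (1 + x\<^sup>2) * cmod (f x)"
        by (simp add: field_simps)
      then have "1 * cmod (f x) \<le> (1 + x\<^sup>2) * cmod (f x) * cmod (f x)"
        by (intro mult_right_mono) simp_all
      then have "cmod (f x) \<le> (1 + x\<^sup>2) * (cmod (f x))\<^sup>2"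
        by (simp add: power2_eq_square mult.assoc)
      moreover have "0 < inverse (1 + x\<^sup>2)" using pos by simp
      ultimately show ?thesis by linarith
    qed (simp add: add_increasing2)
    then show "AE x in Rplus. norm (f x) \<le> norm (inverse (1 + x\<^sup>2) + (1 + x\<^sup>2) * (cmod (f x))\<^sup>2)"
      by (intro AE_I2) (metis abs_of_nonneg norm_ge_zero order_trans real_norm_def)
  qed (rule m)
qed

section \<open>Boundary values and the scattering coefficient\<close>

theorem theorem3p6:
  fixes n k :: nat
    and \<alpha> :: "nat \<Rightarrow> real"
    and v :: "nat \<Rightarrow> real \<Rightarrow> complex"
    and lam :: real
  assumes "\<And>j. j \<in> {1..n} \<Longrightarrow> \<alpha> j \<noteq> 0"
    and "\<And>j. j \<in> {1..n} \<Longrightarrow> v j \<in> borel_measurable Rplus"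
    and "\<And>j. j \<in> {1..n} \<Longrightarrow> integrable Rplus (\<lambda>x. (1 + x\<^sup>2) * (cmod (v j x))\<^sup>2)"
    and "lin_indep n v"
    and "1 \<le> k" and "k \<le> n"
    and "lam \<noteq> 0"
    and "\<And>\<xi>. \<xi> \<in> {lam, - lam} \<Longrightarrow> bv_exists (\<lambda>\<mu>. b_fun \<alpha> v k (\<mu>\<^sup>2)) \<xi>"
    and "\<And>\<xi>. \<xi> \<in> {lam, - lam} \<Longrightarrow> bv_exists (\<lambda>\<mu>. resolvent \<alpha> v (k - 1) (\<mu>\<^sup>2) (v k) 0) \<xi>"
    and "\<And>\<xi>. \<xi> \<in> {lam, - lam} \<Longrightarrow> jost \<alpha> v (k - 1) \<xi> 0 \<noteq> 0"
    and "bv (r_fun \<alpha> v k) lam \<noteq> 0"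
    and "jost_tilde \<alpha> v k lam 0 \<noteq> 0"
  shows "scat_coeff \<alpha> v k lam = jost_tilde \<alpha> v k (- lam) 0 / jost_tilde \<alpha> v k lam 0"
proof -
  have v: "v j \<in> L2 \<and> integrable Rplus (v j)" if "j \<in> {1..n}" for j
    using assms(2,3)[OF that] by (rule weighted_L2_imp_L1_L2)
  define b where "b = bv (\<lambda>\<mu>. b_fun \<alpha> v k (\<mu>\<^sup>2))"
  \<comment> \<open>The factor in front of b_k is continuous in \<mu>, so it passes to its value at
    the real point \<xi>. Convergence has to be shown before \<open>Lim\<close> can be
    evaluated.\<close>
  have r: "bv (r_fun \<alpha> v k) \<xi> = - (2 * \<i> * complex_of_real \<xi> / complex_of_real (\<alpha> k)) * b \<xi>"
    if \<xi>: "\<xi> \<in> {lam, - lam}" for \<xi>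
  proof -
    obtain l where l: "((\<lambda>\<epsilon>. b_fun \<alpha> v k ((upper_path \<xi> \<epsilon>)\<^sup>2)) \<longlongrightarrow> l) (at_right 0)"
      using assms(8)[OF \<xi>] by (auto simp: bv_exists_def)
    then have "b \<xi> = l"
      unfolding b_def bv_def by (intro tendsto_Lim) simp_all
    have "((\<lambda>\<epsilon>. upper_path \<xi> \<epsilon>) \<longlongrightarrow> complex_of_real \<xi> + \<i> * complex_of_real 0) (at_right 0)"
      unfolding upper_path_def by (intro tendsto_intros)
    then have "((\<lambda>\<epsilon>. upper_path \<xi> \<epsilon>) \<longlongrightarrow> complex_of_real \<xi>) (at_right 0)"
      by simp
    then have "((\<lambda>\<epsilon>. r_fun \<alpha> v k (upper_path \<xi> \<epsilon>))
        \<longlongrightarrow> - (2 * \<i> * complex_of_real \<xi> / complex_of_real (\<alpha> k)) * l) (at_right 0)"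
      unfolding r_fun_def divide_inverse by (intro tendsto_intros l)
    then show ?thesis
      unfolding bv_def \<open>b \<xi> = l\<close> by (intro tendsto_Lim) simp_all
  qed
  have jost: "jost_tilde \<alpha> v k \<xi> 0 = - b \<xi>" if \<xi>: "\<xi> \<in> {lam, - lam}" for \<xi>
  proof -
    \<comment> \<open>For \<epsilon> > 0 and \<xi> \<noteq> 0 the spectral parameter has imaginary
      part 2\<xi>\<epsilon> \<noteq> 0, of either sign, so the resolvent is well defined on the
      whole path.\<close>
    have "resolvent \<alpha> v (k - 1) ((upper_path \<xi> \<epsilon>)\<^sup>2) (v k) 0 = 0" if "0 < \<epsilon>" for \<epsilon>
    proof -
      have "Im (upper_path \<xi> \<epsilon>) = \<epsilon>" "Im ((upper_path \<xi> \<epsilon>)\<^sup>2) = 2 * \<xi> * \<epsilon>"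
        by (simp_all add: upper_path_def power2_eq_square)
      then have "resolvent \<alpha> v (k - 1) ((upper_path \<xi> \<epsilon>)\<^sup>2) (v k) \<in> dom_L"
        using v assms(5-7) \<xi> that by (intro resolvent_in_dom_L) auto
      then show ?thesis
        by (simp add: dom_L_def)
    qed
    then have "eventually (\<lambda>\<epsilon>. resolvent \<alpha> v (k - 1) ((upper_path \<xi> \<epsilon>)\<^sup>2) (v k) 0 = 0) (at_right 0)"
      using eventually_at_right_less[of "0::real"] by (auto elim: eventually_mono)
    then have "bv (\<lambda>\<mu>. resolvent \<alpha> v (k - 1) (\<mu>\<^sup>2) (v k) 0) \<xi> = 0"
      unfolding bv_def by (intro tendsto_Lim tendsto_eventually) simp_all
    moreover have "jost_hat \<alpha> v (k - 1) \<xi> 0 = 1"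
      using assms(10)[OF \<xi>] by (simp add: jost_hat_def)
    ultimately show ?thesis
      by (simp add: jost_tilde_def b_def b_fun_def)
  qed
  have "\<alpha> k \<noteq> 0"
    using assms(1,5,6) by simp
  \<comment> \<open>The prefactor of b_k is odd in \<lambda>: its quotient at -\<lambda> and
    \<lambda> is -1, which cancels the minus sign of \<open>scat_coeff\<close>. The signs in
    \<open>jost_tilde = - b\<close> cancel between numerator and denominator.\<close>
  then show ?thesis
    using assms(7) by (simp add: scat_coeff_def r jost)
qed

end
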